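(* There is an absolute constant $C$ such that for every prime $p$ and every multiplicative subgroup $\Gamma\subseteq\mathbb{F}_p^\times$ with $p^{1/2}\leq|\Gamma|\leq p^{2/3}$, $$\mathsf{E}(\Gamma)\leq C\log^{1/4}|\Gamma|\cdot\max\left\{\left(\frac{|\Gamma|^{104}}{p^3}\right)^{1/40},\ \left(\frac{|\Gamma|^{68}}{p^5}\right)^{1/24}\right\}.$$
   Context: $\mathsf{E}(\Gamma)$ is the additive energy: the number of $(x_1,x_2,x_3,x_4)\in\Gamma^4$ with $x_1+x_2=x_3+x_4$ in $\mathbb{F}_p$. Logarithms base $2$. *)

theory Defs
  imports Complex_Main "HOL-Number_Theory.Residues"
begin

definition additive_energy :: "('a, 'b) ring_scheme \<Rightarrow> 'a set \<Rightarrow> nat" where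
  "additive_energy R A =
     card {(x1, x2, x3, x4). x1 \<in> A \<and> x2 \<in> A \<and> x3 \<in> A \<and> x4 \<in> A \<and>
                             x1 \<oplus>\<^bsub>R\<^esub> x2 = x3 \<oplus>\<^bsub>R\<^esub> x4}"

end

theory Submission
  imports Defs "HOL-Computational_Algebra.Computational_Algebra" "HOL-Analysis.Convex"
begin

text \<open>
  Let \<open>\<Gamma>\<close> have order \<open>n\<close>, let \<open>r\<close> count representations as differences of elements of \<open>\<Gamma>\<close>, and write
  \<open>E\<close> for the sum of the \<open>r(d)\<^sup>2\<close>. Sort the residues \<open>x \<noteq> 0, 1\<close> into classes
  by the pair of \<open>x ^ n\<close> and \<open>(1 - x) ^ n\<close>. Stepanov's method shows that only \<open>O(n\<^sup>2 / v\<^sup>3)\<close> classes have at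
  least \<open>v\<close> elements, provided \<open>v\<close> exceeds a multiple of \<open>n\<^sup>2 / p\<close>. In particular the third moment of
  \<open>r\<close> is \<open>O(n\<^sup>3 log n)\<close>.

  Choose a level \<open>t\<close> such that the set \<open>P\<close> of nonzero \<open>d\<close> with \<open>r(d) \<ge> t\<close> satisfies
  \<open>|P| t\<^sup>2 \<ge> E / O(log n)\<close>, and consider the sum of \<open>r(y - z)\<close> over \<open>x, y, z \<in> \<Gamma>\<close> with \<open>x - y, x - z \<in> P\<close>.
  Cauchy--Schwarz bounds it from below by \<open>(|P| t / n)\<^sup>2 E / n\<close>. For the upper bound split the triples by the
  size of the class of \<open>(x - z) / (y - z)\<close>. Large classes contribute \<open>O(n powr (7/3) |P| powr (2/3) log\<^sup>2 n)\<close>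
  by the Stepanov bound; small classes contribute \<open>O((n\<^sup>3 log n |P|\<^sup>2 E / p) powr (1/2))\<close> by
  Cauchy--Schwarz and the third moment. Up to logarithms \<open>E\<close> is therefore at most the maximum of
  \<open>n powr (22/9)\<close>, \<open>n\<^sup>3 p powr (-1/3)\<close> and \<open>n powr (7/3)\<close>, which beats the claim by a power of \<open>n\<close>.
\<close>

section \<open>Stepanov's method modulo a prime\<close>

text \<open>A representation \<open>d = u - y\<close> in \<Gamma> gives the residue
  \<open>u / d\<close>, and \<open>1 - u / d = - y / d\<close>; the \<open>n\<close>-th powers of
  both depend on \<open>d\<close> alone. This is how a bound for classes becomes a bound for
  \<open>r(d)\<close>. The Stepanov bound is silent on classes smaller than about
  \<open>n^2 / p\<close>, which can be of order \<open>n^(1/2)\<close> in the given range. Such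
  classes can only be counted, at the price of the threshold per class, and this produces the term
  \<open>n^3 p^(-1/3)\<close>. The weight \<open>r(y - z)\<close> in the triple sum is chosen so
  that Cauchy--Schwarz returns \<open>E\<close> itself as a factor. In place of dyadic
  decompositions, sums over levels are weighted by \<open>1/s\<close>, so that each costs one
  harmonic sum. The final comparison has room: \<open>p <= n^2\<close> makes the first term of the
  claim at least \<open>n^(49/20)\<close>, above \<open>n^(22/9)\<close> and \<open>n^(7/3)\<close>,
  and \<open>n^3 <= p^2\<close> makes the second at least \<open>n^(1/48)\<close> times
  \<open>n^3 p^(-1/3)\<close>. These spare powers absorb all logarithms.\<close>

text \<open>Polynomials over the field with p elements are represented by integer polynomials; a polynomial
  vanishes modulo p iff \<open>[:int p:]\<close> divides it.\<close>

lemma funpow_pderiv_linear_mult: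
  fixes g :: "int poly"
  shows "(pderiv ^^ Suc k) ([:- x, 1:] * g + [:c:]) =
           [:- x, 1:] * (pderiv ^^ Suc k) g + smult (of_nat (Suc k)) ((pderiv ^^ k) g)"
proof (induction k)
  case 0
  have "pderiv [:- x, 1:] = 1" by (simp add: pderiv_pCons)
  then show ?case
    by (simp only: pderiv_add pderiv_mult funpow.simps comp_apply id_apply)
       (simp add: algebra_simps pderiv_pCons)
next
  case (Suc k)
  have "pderiv [:- x, 1:] = 1" by (simp add: pderiv_pCons)
  then have "pderiv ([:- x, 1:] * (pderiv ^^ Suc k) g + smult (of_nat (Suc k)) ((pderiv ^^ k) g))
     = [:- x, 1:] * (pderiv ^^ Suc (Suc k)) g + smult (of_nat (Suc (Suc k))) ((pderiv ^^ Suc k) g)"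
    by (simp only: pderiv_add pderiv_mult pderiv_smult funpow.simps comp_apply)
       (simp add: algebra_simps smult_add_left numeral_poly)
  then show ?case using Suc by simp
qed

text \<open>Induction on the total multiplicity: synthetic division removes one factor at a root
  \<open>x\<close>, with a remainder divisible by \<open>p\<close>. Multiplicity is measured by
  derivatives, and passing from derivative \<open>k + 1\<close> of \<open>f\<close> to derivative
  \<open>k\<close> of the quotient divides by \<open>k + 1\<close>; \<open>m x <= p\<close> keeps
  that number a unit.\<close>

lemma sum_root_multiplicity_mod_le_degree:
  fixes f :: "int poly" and p :: nat
  assumes p: "prime p" and fin: "finite S"
    and inj: "\<And>x y. x \<in> S \<Longrightarrow> y \<in> S \<Longrightarrow> int p dvd x - y \<Longrightarrow> x = y"
    and nz: "\<not> [:int p:] dvd f"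
    and mp: "\<And>x. x \<in> S \<Longrightarrow> m x \<le> p"
    and van: "\<And>x k. x \<in> S \<Longrightarrow> k < m x \<Longrightarrow> int p dvd poly ((pderiv ^^ k) f) x"
  shows "(\<Sum>x\<in>S. m x) \<le> degree f"
  using nz mp van
proof (induction "\<Sum>x\<in>S. m x" arbitrary: f m)
  case 0
  then show ?case by simp
next
  case (Suc s)
  have pp: "prime (int p)" using p by simp
  note vanf = Suc.prems(3)
  have "\<exists>x\<in>S. m x \<noteq> 0"
  proof (rule ccontr)
    assume "\<not> ?thesis"
    then have "(\<Sum>x\<in>S. m x) = 0" by simp
    then show False using Suc.hyps(2) by simp
  qed
  then obtain x where x: "x \<in> S" "m x > 0" by auto
  define g where "g = synthetic_div f x"
  define c where "c = poly f x"
  have fg: "f = [:- x, 1:] * g + [:c:]"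
    unfolding g_def c_def by (rule synthetic_div_correct'[symmetric])
  have pc: "int p dvd c" using Suc.prems(3)[OF x] by (simp add: c_def)
  have ng: "\<not> [:int p:] dvd g"
  proof
    assume "[:int p:] dvd g"
    moreover have "[:int p:] dvd [:c:]" using pc by (simp add: const_poly_dvd_iff coeff_pCons split: nat.split)
    ultimately have "[:int p:] dvd f" unfolding fg by (intro dvd_add dvd_mult) auto
    then show False using Suc.prems(1) by simp
  qed
  have "degree f \<noteq> 0"
  proof
    assume "degree f = 0"
    then have "g = 0" by (simp add: g_def synthetic_div_eq_0_iff)
    then show False using ng by simp
  qed
  moreover have "degree g = degree f - 1" by (simp add: g_def degree_synthetic_div)
  ultimately have dg: "degree f = Suc (degree g)" by simp
  define m' where "m' = m(x := m x - 1)"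
  have van': "int p dvd poly ((pderiv ^^ k) g) y" if "y \<in> S" "k < m' y" for y k
  proof (cases "y = x")
    case True
    have "Suc k < m x" using that True by (simp add: m'_def)
    then have "int p dvd poly ((pderiv ^^ Suc k) f) x" using Suc.prems(3) x by blast
    also have "poly ((pderiv ^^ Suc k) f) x = int (Suc k) * poly ((pderiv ^^ k) g) x"
      unfolding fg funpow_pderiv_linear_mult by simp
    finally have "int p dvd int (Suc k) \<or> int p dvd poly ((pderiv ^^ k) g) x"
      using prime_dvd_mult_iff pp by blast
    moreover have "\<not> int p dvd int (Suc k)"
    proof -
      have "Suc k < p" using \<open>Suc k < m x\<close> Suc.prems(2)[OF x(1)] by simp
      then show ?thesis using nat_dvd_not_less[of "Suc k" p] by (simp only: int_dvd_int_iff) simp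
    qed
    ultimately show ?thesis using True by simp
  next
    case False
    have nd: "\<not> int p dvd y - x" using inj[OF that(1) x(1)] False by blast
    have km: "k < m y" using that False by (simp add: m'_def)
    \<comment> \<open>At the other roots no order is lost: \<open>y - x\<close> is a unit, and the
      extra term in derivative \<open>j + 1\<close> is a multiple of derivative \<open>j\<close>,
      already known to vanish.\<close>
    have "\<forall>j\<le>k. int p dvd poly ((pderiv ^^ j) g) y"
    proof
      fix j show "j \<le> k \<longrightarrow> int p dvd poly ((pderiv ^^ j) g) y"
      proof (induction j)
        case 0
        have "int p dvd poly f y" using Suc.prems(3)[OF that(1), of 0] km by simp
        also have "poly f y = (y - x) * poly g y + c" unfolding fg by (simp add: algebra_simps)
        finally have "int p dvd (y - x) * poly g y" using pc by (simp add: dvd_add_left_iff)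
        then have "int p dvd poly g y" using prime_dvd_mult_iff pp nd by blast
        then show ?case by simp
      next
        case (Suc j)
        show ?case
        proof
          assume jk: "Suc j \<le> k"
          have "int p dvd poly ((pderiv ^^ Suc j) f) y" using vanf[OF that(1), of "Suc j"] jk km by linarith
          also have "poly ((pderiv ^^ Suc j) f) y = (y - x) * poly ((pderiv ^^ Suc j) g) y
               + int (Suc j) * poly ((pderiv ^^ j) g) y"
            unfolding fg funpow_pderiv_linear_mult by (simp add: algebra_simps)
          finally have "int p dvd (y - x) * poly ((pderiv ^^ Suc j) g) y"
            using Suc jk by (simp add: dvd_add_left_iff)
          then show "int p dvd poly ((pderiv ^^ Suc j) g) y" using prime_dvd_mult_iff pp nd by blast
        qed
      qed
    qed
    then show ?thesis by blast
  qed
  have "(\<Sum>y\<in>S. m y) = m x + (\<Sum>y\<in>S-{x}. m y)" using fin x by (simp add: sum.remove)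
  moreover have "(\<Sum>y\<in>S. m' y) = (m x - 1) + (\<Sum>y\<in>S-{x}. m y)"
    using fin x by (subst sum.remove[of S x]) (auto simp: m'_def intro!: sum.cong)
  ultimately have s: "s = (\<Sum>y\<in>S. m' y)" using x Suc.hyps(2) by simp
  have "(\<Sum>y\<in>S. m' y) \<le> degree g"
    using Suc.hyps(1)[OF s ng] van' Suc.prems(2) by (force simp: m'_def split: if_splits)
  then show ?case using s Suc.hyps(2) dg by simp
qed

text \<open>The functional \<open>X ^ i \<mapsto> q i\<close>. It turns multiplication by \<open>1 - X\<close> into a finite difference of \<open>q\<close>,
  so it annihilates the multiples of \<open>(1 - X) ^ n\<close> as soon as \<open>degree q < n\<close>.\<close>

definition coeff_pairing :: "int poly \<Rightarrow> int poly \<Rightarrow> int" where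
  "coeff_pairing q f = (\<Sum>i\<le>degree f. coeff f i * poly q (int i))"

lemma coeff_pairing_eq_sum:
  assumes "degree f \<le> T"
  shows "coeff_pairing q f = (\<Sum>i\<le>T. coeff f i * poly q (int i))"
  unfolding coeff_pairing_def using assms
  by (intro sum.mono_neutral_left) (auto simp: coeff_eq_0)

lemma coeff_pairing_add: "coeff_pairing q (f + g) = coeff_pairing q f + coeff_pairing q g"
proof -
  define T where "T = max (degree f) (degree g)"
  have "degree f \<le> T" "degree g \<le> T" "degree (f + g) \<le> T" by (auto simp: T_def degree_add_le)
  then show ?thesis by (simp add: coeff_pairing_eq_sum[where T=T] algebra_simps sum.distrib)
qed

lemma coeff_pairing_one_minus_X_mult:
  "coeff_pairing q ([:1, -1:] * f) = coeff_pairing (q - pcompose q [:1, 1:]) f"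
proof -
  define T where "T = degree f"
  have "degree ([:1, -1:] * f) \<le> Suc T"
    using degree_mult_le[of "[:1, -1:]" f] by (simp add: T_def)
  then have "coeff_pairing q ([:1, -1:] * f) = (\<Sum>i\<le>Suc T. coeff ([:1, -1:] * f) i * poly q (int i))"
    by (rule coeff_pairing_eq_sum)
  also have "\<dots> = (\<Sum>i\<le>Suc T. coeff f i * poly q (int i)) - (\<Sum>i\<le>Suc T. coeff (pCons 0 f) i * poly q (int i))"
  proof -
    have "[:1, -1:] * f = f - pCons 0 f" by simp
    then show ?thesis by (simp only: sum_subtractf[symmetric] coeff_diff left_diff_distrib)
  qed
  also have "(\<Sum>i\<le>Suc T. coeff f i * poly q (int i)) = (\<Sum>i\<le>T. coeff f i * poly q (int i))"
    by (simp add: T_def coeff_eq_0)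
  also have "(\<Sum>i\<le>Suc T. coeff (pCons 0 f) i * poly q (int i)) = (\<Sum>i\<le>T. coeff f i * poly q (int (Suc i)))"
    by (subst sum.atMost_Suc_shift) simp
  finally show ?thesis
    by (simp add: coeff_pairing_def T_def sum_subtractf[symmetric] poly_pcompose algebra_simps)
qed

lemma degree_finite_difference:
  fixes q :: "int poly"
  shows "q - pcompose q [:1, 1:] = 0 \<or> degree (q - pcompose q [:1, 1:]) < degree q"
proof (cases "degree q = 0")
  case True
  then obtain c where "q = [:c:]" using degree_eq_zeroE by blast
  then show ?thesis by simp
next
  case False
  have d: "degree (pcompose q [:1, 1:]) = degree q" by (simp add: degree_pcompose)
  have "lead_coeff (pcompose q [:1, 1:]) = lead_coeff q"
    by (subst lead_coeff_comp) auto
  then have "coeff (q - pcompose q [:1, 1:]) (degree q) = 0" using d by simp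
  moreover have "degree (q - pcompose q [:1, 1:]) \<le> degree q" using d by (metis degree_diff_le order_refl)
  ultimately show ?thesis using False
    by (metis degree_0 eq_zero_or_degree_less)
qed

lemma coeff_pairing_power_eq_0:
  assumes "q = 0 \<or> degree q < n"
  shows "coeff_pairing q ([:1, -1:] ^ n * f) = 0"
  using assms
proof (induction n arbitrary: q)
  case 0
  then show ?case by (simp add: coeff_pairing_def)
next
  case (Suc n)
  have "coeff_pairing q ([:1, -1:] ^ Suc n * f) = coeff_pairing (q - pcompose q [:1, 1:]) ([:1, -1:] ^ n * f)"
    by (simp only: power_Suc mult.assoc coeff_pairing_one_minus_X_mult)
  moreover have "q - pcompose q [:1, 1:] = 0 \<or> degree (q - pcompose q [:1, 1:]) < n"
    using Suc.prems degree_finite_difference[of q] by auto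
  ultimately show ?case using Suc.IH by simp
qed

text \<open>Take \<open>q\<close> vanishing at every exponent except \<open>i0\<close>. Its degree
  is below \<open>n\<close>, so the pairing kills the multiple of \<open>(1 - X) ^ n\<close>, while
  on the left it isolates \<open>c i0 * q(i0)\<close>. The exponents are below \<open>p\<close>,
  hence distinct modulo \<open>p\<close>, and \<open>q(i0)\<close> is a unit.\<close>

lemma dvd_coeff_of_sparse_multiple:
  fixes c :: "nat \<Rightarrow> int" and p :: nat
  assumes p: "prime p" and I: "finite I" "card I \<le> n" "\<And>i. i \<in> I \<Longrightarrow> i < p"
    and eq: "(\<Sum>i\<in>I. monom (c i) i) = [:1, -1:] ^ n * g + [:int p:] * h"
    and i0: "i0 \<in> I"
  shows "int p dvd c i0"
proof -
  define q where "q = (\<Prod>i\<in>I-{i0}. [:- int i, 1:])"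
  have "degree q \<le> card (I - {i0})"
    unfolding q_def by (rule order.trans[OF degree_prod_sum_le]) (use I in auto)
  moreover have "card (I - {i0}) < card I" using I i0 by (meson card_Diff1_less)
  ultimately have dq: "degree q < n" using I by simp
  define f where "f = (\<Sum>i\<in>I. monom (c i) i)"
  have cf: "coeff f i = (if i \<in> I then c i else 0)" for i
    unfolding f_def coeff_sum using I by (simp add: sum.delta)
  have "degree f \<le> p"
    unfolding f_def by (rule degree_sum_le) (use I in \<open>auto intro: order.trans[OF degree_monom_le] less_imp_le\<close>)
  then have "coeff_pairing q f = (\<Sum>i\<le>p. coeff f i * poly q (int i))"
    by (rule coeff_pairing_eq_sum)
  also have "\<dots> = (\<Sum>i\<in>{i0}. coeff f i * poly q (int i))"
  proof (rule sum.mono_neutral_right)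
    show "\<forall>i\<in>{..p} - {i0}. coeff f i * poly q (int i) = 0"
    proof
      fix i assume "i \<in> {..p} - {i0}"
      then show "coeff f i * poly q (int i) = 0"
        using I by (cases "i \<in> I") (auto simp: cf q_def poly_prod)
    qed
  qed (use I i0 in \<open>auto intro: less_imp_le\<close>)
  finally have 1: "coeff_pairing q f = c i0 * poly q (int i0)" by (simp add: cf i0)
  have "coeff_pairing q f = coeff_pairing q ([:int p:] * h)"
    unfolding f_def eq coeff_pairing_add using coeff_pairing_power_eq_0 dq by simp
  moreover have "int p dvd coeff_pairing q ([:int p:] * h)"
    unfolding coeff_pairing_def by (intro dvd_sum) simp
  ultimately have "int p dvd c i0 * poly q (int i0)" using 1 by simp
  moreover have "\<not> int p dvd poly q (int i0)"
  proof
    assume "int p dvd poly q (int i0)"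
    then have "int p dvd (\<Prod>i\<in>I-{i0}. int i0 - int i)" by (simp add: q_def poly_prod)
    then obtain i where i: "i \<in> I" "i \<noteq> i0" "int p dvd int i0 - int i"
      using prime_dvd_prod_iff[of "I-{i0}" "int p"] I p by auto
    have "\<bar>int i0 - int i\<bar> < int p" using I(3)[OF i(1)] I(3)[OF i0] by linarith
    then show False using i zdvd_imp_le[of "int p" "\<bar>int i0 - int i\<bar>"] by force
  qed
  ultimately show ?thesis using p prime_dvd_mult_iff[of "int p"] by auto
qed

section \<open>Derivatives and independence of the auxiliary monomials\<close>

text \<open>A derivative costs at most one factor \<open>X\<close> and one factor
  \<open>1 - X\<close>; restoring these keeps the large powers intact and leaves a cofactor whose
  degree is free of \<open>m\<close> and \<open>l\<close>. For \<open>m = n * b\<close> and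
  \<open>l = n * c\<close> the large powers are constant on a shift class, so vanishing there costs
  few linear conditions.\<close>

lemma funpow_pderiv_X_one_minus_X:
  "\<exists>U :: int poly. degree U \<le> a + k \<and>
     [:0, 1:] ^ k * [:1, -1:] ^ k * (pderiv ^^ k) ([:0, 1:] ^ (a + m) * [:1, -1:] ^ l) =
     [:0, 1:] ^ m * [:1, -1:] ^ l * U"
proof (induction k)
  case 0
  have "degree ([:0, 1:] ^ a :: int poly) \<le> a" by (simp add: degree_linear_power)
  then show ?case by (intro exI[of _ "[:0, 1:] ^ a"]) (simp add: power_add algebra_simps)
next
  case (Suc k)
  define X :: "int poly" where "X = [:0, 1:]"
  define Y :: "int poly" where "Y = [:1, -1:]"
  define G where "G = (pderiv ^^ k) (X ^ (a + m) * Y ^ l)"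
  from Suc obtain U where U: "degree U \<le> a + k" "X ^ k * Y ^ k * G = X ^ m * Y ^ l * U"
    unfolding X_def Y_def G_def by blast
  have dX1: "pderiv X = 1" and dY1: "pderiv Y = - 1" by (simp_all add: X_def Y_def pderiv_pCons one_pCons)
  have dX: "X * pderiv (X ^ j) = of_nat j * X ^ j" for j
  proof (cases j)
    case (Suc i)
    have "pderiv (X ^ j) = smult (of_nat (Suc i)) (X ^ i) * pderiv X" unfolding Suc by (rule pderiv_power_Suc)
    then show ?thesis by (simp add: dX1 Suc of_nat_poly)
  qed simp
  have dY: "Y * pderiv (Y ^ j) = - of_nat j * Y ^ j" for j
  proof (cases j)
    case (Suc i)
    have "pderiv (Y ^ j) = smult (of_nat (Suc i)) (Y ^ i) * pderiv Y" unfolding Suc by (rule pderiv_power_Suc)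
    then show ?thesis by (simp add: dY1 Suc of_nat_poly flip: smult_minus_left)
  qed simp
  have key: "X * Y * pderiv (X ^ i * Y ^ j * H) =
      X ^ i * Y ^ j * ((of_nat i * Y - of_nat j * X) * H + X * Y * pderiv H)" for i j H
  proof -
    have "X * Y * pderiv (X ^ i * Y ^ j * H) = (X * pderiv (X ^ i)) * Y ^ j * Y * H
       + (Y * pderiv (Y ^ j)) * X ^ i * X * H + X * Y * X ^ i * Y ^ j * pderiv H"
      by (simp add: pderiv_mult algebra_simps)
    then show ?thesis unfolding dX dY by (simp add: algebra_simps)
  qed
  \<comment> \<open>The last term removes what differentiating the prefactor
    \<open>X ^ k * Y ^ k\<close> contributes.\<close>
  define V where "V = (of_nat m * Y - of_nat l * X) * U + X * Y * pderiv U - of_nat k * (Y - X) * U"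
  have "X ^ k * Y ^ k * ((of_nat k * Y - of_nat k * X) * G + X * Y * pderiv G) =
        X ^ m * Y ^ l * ((of_nat m * Y - of_nat l * X) * U + X * Y * pderiv U)"
    using key[of k k G] key[of m l U] U(2) by simp
  then have "X ^ Suc k * Y ^ Suc k * pderiv G =
     X ^ m * Y ^ l * ((of_nat m * Y - of_nat l * X) * U + X * Y * pderiv U) - of_nat k * (Y - X) * (X ^ k * Y ^ k * G)"
    by (simp add: algebra_simps)
  then have eq: "X ^ Suc k * Y ^ Suc k * pderiv G = X ^ m * Y ^ l * V"
    unfolding U(2) V_def by (simp add: algebra_simps)
  have d1: "degree (of_nat i * Y - of_nat j * X) \<le> 1" for i j
    by (simp add: X_def Y_def of_nat_poly)
  have "degree ((of_nat m * Y - of_nat l * X) * U) \<le> a + Suc k"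
    using degree_mult_le[of "of_nat m * Y - of_nat l * X" U] d1[of m l] U(1) by linarith
  moreover have "degree (of_nat k * (Y - X) * U) \<le> a + Suc k"
  proof -
    have "of_nat k * (Y - X) = of_nat k * Y - of_nat k * X" by (simp add: algebra_simps)
    then show ?thesis using degree_mult_le[of "of_nat k * (Y - X)" U] d1[of k k] U(1) by simp
  qed
  moreover have "degree (X * Y * pderiv U) \<le> a + Suc k"
  proof (cases "degree U = 0")
    case True
    then have "pderiv U = 0" by (simp add: pderiv_eq_0_iff)
    then show ?thesis by simp
  next
    case False
    have "degree (X * Y) \<le> 2" by (simp add: X_def Y_def)
    then show ?thesis using degree_mult_le[of "X * Y" "pderiv U"] degree_pderiv[of U] U(1) False by simp
  qed
  ultimately have "degree V \<le> a + Suc k"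
    unfolding V_def by (intro degree_diff_le degree_add_le)
  then show ?case using eq unfolding X_def Y_def G_def by (intro exI[of _ V]) simp
qed

text \<open>Strong induction on \<open>c\<close>. With the lower blocks zero modulo
  \<open>p\<close>, dividing by \<open>(1 - X) ^ (n * c)\<close> leaves block \<open>c\<close>
  congruent to a multiple of \<open>(1 - X) ^ n\<close>. The block has at most
  \<open>A * B <= n\<close> monomials, with exponents distinct by \<open>A <= n\<close> and below
  \<open>n * B <= p\<close>, so \<open>dvd_coeff_of_sparse_multiple\<close> applies.\<close>

lemma stepanov_monomials_independent_mod:
  fixes l :: "nat \<Rightarrow> nat \<Rightarrow> nat \<Rightarrow> int" and p :: nat
  assumes p: "prime p" and AB: "A * B \<le> n" "A \<le> n" "n * B \<le> p"
    and dvd: "[:int p:] dvd (\<Sum>c<B. \<Sum>(a, b)\<in>{..<A} \<times> {..<B}.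
                smult (l a b c) ([:0, 1:] ^ (a + n * b) * [:1, -1:] ^ (n * c)))"
    and abc: "a < A" "b < B" "c < B"
  shows "int p dvd l a b c"
  using abc
proof (induction c arbitrary: a b rule: less_induct)
  case (less c)
  define Y :: "int poly" where "Y = [:1, -1:]"
  define f where "f c = (\<Sum>(a, b)\<in>{..<A} \<times> {..<B}. smult (l a b c) ([:0, 1:] ^ (a + n * b)))" for c
  have n: "n > 0" using less.prems AB by linarith
  have pp: "prime (int p)" using p by simp
  have F: "(\<Sum>c<B. \<Sum>(a, b)\<in>{..<A} \<times> {..<B}. smult (l a b c) ([:0, 1:] ^ (a + n * b) * [:1, -1:] ^ (n * c)))
      = (\<Sum>c<B. Y ^ (n * c) * f c)"
    unfolding f_def Y_def sum_distrib_left by (intro sum.cong refl) (auto simp: algebra_simps)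
  have fd: "[:int p:] dvd f c'" if "c' < c" for c'
    unfolding f_def
  proof (intro dvd_sum)
    fix ab assume "ab \<in> {..<A} \<times> {..<B}"
    then have "int p dvd l (fst ab) (snd ab) c'" using less.IH[OF that] that less.prems(3) by auto
    then show "[:int p:] dvd (case ab of (a, b) \<Rightarrow> smult (l a b c') ([:0, 1:] ^ (a + n * b)))"
      by (auto simp: const_poly_dvd_iff split: prod.split)
  qed
  define G where "G = (\<Sum>c'\<in>{c<..<B}. Y ^ (n * (c' - Suc c)) * f c')"
  have "{..<B} = {..<c} \<union> ({c} \<union> {c<..<B})" using less.prems by auto
  then have "(\<Sum>c<B. Y ^ (n * c) * f c) = (\<Sum>c'\<in>{..<c} \<union> ({c} \<union> {c<..<B}). Y ^ (n * c') * f c')"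
    by simp
  also have "\<dots> = (\<Sum>c'<c. Y ^ (n * c') * f c') + (\<Sum>c'\<in>{c} \<union> {c<..<B}. Y ^ (n * c') * f c')"
    by (rule sum.union_disjoint) auto
  also have "(\<Sum>c'\<in>{c} \<union> {c<..<B}. Y ^ (n * c') * f c') = Y ^ (n * c) * f c +
       (\<Sum>c'\<in>{c<..<B}. Y ^ (n * c') * f c')"
    by (subst sum.union_disjoint) auto
  also have "(\<Sum>c'\<in>{c<..<B}. Y ^ (n * c') * f c') = Y ^ (n * c) * (Y ^ n * G)"
    unfolding G_def sum_distrib_left
  proof (rule sum.cong[OF refl])
    fix c' assume "c' \<in> {c<..<B}"
    then obtain d where "c' = Suc c + d" using less_imp_Suc_add by force
    then have "n * c' = n * c + n + n * (c' - Suc c)" by (simp add: algebra_simps)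
    then show "Y ^ (n * c') * f c' = Y ^ (n * c) * (Y ^ n * (Y ^ (n * (c' - Suc c)) * f c'))"
      by (simp add: power_add mult.assoc)
  qed
  finally have "(\<Sum>c<B. Y ^ (n * c) * f c) = (\<Sum>c'<c. Y ^ (n * c') * f c') + Y ^ (n * c) * (f c + Y ^ n * G)"
    by (simp add: algebra_simps)
  moreover have "[:int p:] dvd (\<Sum>c'<c. Y ^ (n * c') * f c')"
    by (intro dvd_sum dvd_mult) (use fd in auto)
  ultimately have "[:int p:] dvd Y ^ (n * c) * (f c + Y ^ n * G)"
    using dvd unfolding F by (simp add: dvd_add_right_iff)
  moreover have pe: "prime_elem [:int p:]" using pp by (simp add: prime_elem_const_poly_iff)
  moreover have "\<not> [:int p:] dvd Y"
  proof
    assume "[:int p:] dvd Y"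
    then have "int p dvd coeff Y 0" by (simp only: const_poly_dvd_iff)
    then show False using pp by (simp add: Y_def)
  qed
  ultimately have "[:int p:] dvd f c + Y ^ n * G"
    using prime_elem_dvd_mult_iff prime_elem_dvd_power by blast
  then obtain h where h: "f c + Y ^ n * G = [:int p:] * h" by (elim dvdE)
  define I where "I = (\<lambda>(a, b). a + n * b) ` ({..<A} \<times> {..<B})"
  have inj: "inj_on (\<lambda>(a, b). a + n * b) ({..<A} \<times> {..<B})"
  proof (rule inj_onI, clarsimp)
    fix a b a' b' assume *: "a < A" "a' < A" "a + n * b = a' + n * b'"
    then have "a < n" "a' < n" using AB by linarith+
    then have "(a + n * b) mod n = a" "(a' + n * b') mod n = a'" by simp_all
    then have "a = a'" using * by metis
    then show "a = a' \<and> b = b'" using * n by simp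
  qed
  have fI: "f c = (\<Sum>i\<in>I. monom (l (i mod n) (i div n) c) i)"
    unfolding I_def sum.reindex[OF inj] f_def
  proof (intro sum.cong refl)
    fix ab assume "ab \<in> {..<A} \<times> {..<B}"
    then obtain a b where ab: "ab = (a, b)" "a < A" "b < B" by auto
    have "(a + n * b) mod n = a" "(a + n * b) div n = b" using ab AB n by auto
    then show "(case ab of (a, b) \<Rightarrow> smult (l a b c) ([:0, 1:] ^ (a + n * b))) =
       ((\<lambda>i. monom (l (i mod n) (i div n) c) i) \<circ> (\<lambda>(a, b). a + n * b)) ab"
      unfolding ab(1) by (simp add: monom_altdef)
  qed
  have "int p dvd l ((a + n * b) mod n) ((a + n * b) div n) c"
  proof (rule dvd_coeff_of_sparse_multiple[where c = "\<lambda>i. l (i mod n) (i div n) c", OF p])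
    show "finite I" by (simp add: I_def)
    show "card I \<le> n" unfolding I_def card_image[OF inj] using AB by simp
    show "i < p" if "i \<in> I" for i
    proof -
      from that obtain a b where ab: "i = a + n * b" "a < A" "b < B" by (auto simp: I_def)
      then have "i < n * Suc b" using AB by simp
      also have "\<dots> \<le> n * B" using ab by (intro mult_le_mono) auto
      finally show ?thesis using AB by simp
    qed
    show "(\<Sum>i\<in>I. monom (l (i mod n) (i div n) c) i) = [:1, - 1:] ^ n * (- G) + [:int p:] * h"
      using h unfolding fI[symmetric] Y_def by (simp add: algebra_simps)
    show "a + n * b \<in> I" using less.prems by (auto simp: I_def)
  qed
  moreover have "(a + n * b) mod n = a" "(a + n * b) div n = b" using less.prems AB n by auto
  ultimately show ?case by simp
qed

section \<open>Shift classes and the auxiliary polynomial\<close>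

text \<open>Away from 0 and 1, a nonempty class is the intersection of a coset of the
  \<open>n\<close>-th roots of unity with the reflection under \<open>x -> 1 - x\<close> of another;
  powers serve as names for the cosets.\<close>

definition shift_class :: "nat \<Rightarrow> nat \<Rightarrow> int \<Rightarrow> int \<times> int" where
  "shift_class p n x = (x ^ n mod int p, (1 - x) ^ n mod int p)"

text \<open>More unknowns than homogeneous conditions modulo \<open>p\<close>. Pigeonhole among the
  \<open>p ^ card I\<close> reduced vectors gives two with equal images; their difference is the
  solution.\<close>

lemma exists_vanishing_auxiliary_coefficients:
  fixes w :: "'i \<Rightarrow> 'j \<Rightarrow> int" and p :: nat
  assumes "finite I" "finite J" "card J < card I" "p > 1"
  shows "\<exists>l. (\<exists>i\<in>I. \<not> int p dvd l i) \<and> (\<forall>j\<in>J. int p dvd (\<Sum>i\<in>I. l i * w i j))"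
proof -
  let ?D = "PiE I (\<lambda>_. {0..<int p})"
  let ?R = "PiE J (\<lambda>_. {0..<int p})"
  define \<Phi> where "\<Phi> l = (\<lambda>j\<in>J. (\<Sum>i\<in>I. l i * w i j) mod int p)" for l
  have "card ?R = p ^ card J" "card ?D = p ^ card I" using assms by (simp_all add: card_PiE)
  then have "card ?R < card ?D" using assms by simp
  moreover have "\<Phi> ` ?D \<subseteq> ?R" using assms by (auto simp: \<Phi>_def)
  moreover have "finite ?R" using assms by (intro finite_PiE) auto
  ultimately have "\<not> inj_on \<Phi> ?D"
    by (meson card_inj_on_le leD)
  then obtain l l' where l: "l \<in> ?D" "l' \<in> ?D" "\<Phi> l = \<Phi> l'" "l \<noteq> l'" unfolding inj_on_def by blast
  then obtain i where i: "i \<in> I" "l i \<noteq> l' i" by (metis PiE_ext)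
  have "\<not> int p dvd l i - l' i"
  proof
    assume "int p dvd l i - l' i"
    then have "l i mod int p = l' i mod int p" by (simp add: mod_eq_dvd_iff)
    moreover have "l i \<in> {0..<int p}" "l' i \<in> {0..<int p}" using l i by (auto dest: PiE_mem)
    ultimately show False using i by simp
  qed
  moreover have "int p dvd (\<Sum>i\<in>I. (l i - l' i) * w i j)" if "j \<in> J" for j
  proof -
    have "(\<Sum>i\<in>I. l i * w i j) mod int p = (\<Sum>i\<in>I. l' i * w i j) mod int p"
      using fun_cong[OF l(3), of j] that by (simp add: \<Phi>_def)
    then show ?thesis by (simp add: mod_eq_dvd_iff left_diff_distrib sum_subtractf)
  qed
  ultimately show ?thesis using i by (intro exI[of _ "\<lambda>i. l i - l' i"]) auto
qed

lemma pderiv_sum_distrib: "pderiv (\<Sum>i\<in>I. f i) = (\<Sum>i\<in>I. pderiv (f i))"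
  by (induction I rule: infinite_finite_induct) (simp_all add: pderiv_add)

text \<open>The auxiliary polynomial has \<open>A * B^2\<close> coefficients, with \<open>A\<close>
  about \<open>n / B\<close>, and is to vanish to order \<open>A\<close> on all classes in
  \<open>K\<close>. On one class derivative \<open>k\<close> becomes, up to units, a polynomial of
  degree below \<open>2 * A\<close>, hence \<open>2 * A^2\<close> conditions; the hypothesis on
  \<open>card K\<close> makes these fewer than the coefficients. Comparing \<open>card S * A\<close>
  with the degree \<open>2 * n * B\<close> gives the bound.\<close>

theorem stepanov_shift_class_bound:
  fixes p n B :: nat
  assumes p: "prime p" and B: "0 < B" "B \<le> n" "n * B \<le> p"
    and K: "finite K" "2 * card K * n < B ^ 3"
  shows "card {x \<in> {2..<int p}. shift_class p n x \<in> K} \<le> 4 * B ^ 2"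
proof -
  define S where "S = {x \<in> {2..<int p}. shift_class p n x \<in> K}"
  define A where "A = n div B"
  have pp: "prime (int p)" using p by simp
  have A: "0 < A" using B by (simp add: A_def div_greater_zero_iff)
  have AB: "A * B \<le> n" by (simp add: A_def)
  \<comment> \<open>Rounding in \<open>A\<close> loses at most a factor 2, which accounts for 4
    instead of 2 in the conclusion.\<close>
  have nAB: "n \<le> 2 * (A * B)"
  proof -
    have "n = A * B + n mod B" by (simp add: A_def)
    moreover have "n mod B < B" using B by simp
    moreover have "B \<le> A * B" using A by simp
    ultimately show ?thesis by linarith
  qed
  have An: "A \<le> n" by (simp add: A_def)
  have Ap: "A \<le> p" using An B by (metis One_nat_def Suc_leI le_trans mult.right_neutral mult_le_mono2)
  define X :: "int poly" where "X = [:0, 1:]"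
  define Y :: "int poly" where "Y = [:1, -1:]"
  have "\<forall>a b c k. \<exists>U. degree U \<le> a + k \<and> X ^ k * Y ^ k * (pderiv ^^ k) (X ^ (a + n * b) * Y ^ (n * c)) =
     X ^ (n * b) * Y ^ (n * c) * U"
    unfolding X_def Y_def using funpow_pderiv_X_one_minus_X by blast
  then obtain U where U: "\<And>a b c k. degree (U a b c k) \<le> a + k"
     "\<And>a b c k. X ^ k * Y ^ k * (pderiv ^^ k) (X ^ (a + n * b) * Y ^ (n * c)) = X ^ (n * b) * Y ^ (n * c) * U a b c k"
    by (simp only: choice_iff) blast
  define I where "I = {..<B} \<times> {..<A} \<times> {..<B}"
  define J where "J = K \<times> {..<A} \<times> {..<2 * A}"
  \<comment> \<open>The coefficient of \<open>X ^ j\<close> in derivative \<open>k\<close> of one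
    monomial after \<open>x ^ n\<close> and \<open>(1 - x) ^ n\<close> are replaced by the values
    \<open>s\<close> and \<open>t\<close> of the class.\<close>
  define w :: "nat \<times> nat \<times> nat \<Rightarrow> (int \<times> int) \<times> nat \<times> nat \<Rightarrow> int"
    where "w = (\<lambda>(c, a, b) ((s, t), k, j). s ^ b * t ^ c * coeff (U a b c k) j)"
  have "card J < card I"
  proof -
    have "2 * card K * A * B \<le> 2 * card K * n" using mult_le_mono2[OF AB, of "2 * card K"] by (simp add: mult.assoc)
    then have "2 * card K * A * B < B ^ 3" using K by linarith
    then have "(2 * card K * A) * B < (B * B) * B" by (simp add: power3_eq_cube)
    then have "2 * card K * A < B * B" by (simp only: mult_less_cancel2)
    then have "A * (2 * card K * A) < A * (B * B)" using A by simp
    then show ?thesis by (simp add: I_def J_def card_cartesian_product algebra_simps)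
  qed
  then obtain l where l: "\<exists>i\<in>I. \<not> int p dvd l i" "\<forall>j\<in>J. int p dvd (\<Sum>i\<in>I. l i * w i j)"
    using exists_vanishing_auxiliary_coefficients[of I J p w] K prime_gt_1_nat[OF p]
    by (auto simp: I_def J_def)
  define F where "F = (\<Sum>(c, a, b)\<in>I. smult (l (c, a, b)) (X ^ (a + n * b) * Y ^ (n * c)))"
  have nF: "\<not> [:int p:] dvd F"
  proof
    assume "[:int p:] dvd F"
    then have *: "[:int p:] dvd (\<Sum>c<B. \<Sum>(a, b)\<in>{..<A} \<times> {..<B}.
                smult (l (c, a, b)) ([:0, 1:] ^ (a + n * b) * [:1, -1:] ^ (n * c)))"
      unfolding F_def I_def X_def Y_def by (simp add: sum.cartesian_product)
    have "int p dvd l (c, a, b)" if "a < A" "b < B" "c < B" for a b c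
      using stepanov_monomials_independent_mod[OF p AB An B(3) *] that by simp
    then show False using l(1) by (auto simp: I_def)
  qed
  have degF: "degree F \<le> 2 * n * B"
    unfolding F_def
  proof (rule degree_sum_le, goal_cases)
    case (2 i)
    then obtain a b c where i: "i = (c, a, b)" "a < A" "b < B" "c < B" by (auto simp: I_def)
    have "degree (X ^ (a + n * b) * Y ^ (n * c)) \<le> (a + n * b) + n * c"
      by (rule order.trans[OF degree_mult_le])
         (simp add: X_def Y_def degree_linear_power order.trans[OF degree_power_le])
    also have "\<dots> \<le> n * Suc b + n * Suc c" using i An by simp
    also have "\<dots> \<le> n * B + n * B" using i by (intro add_mono mult_le_mono) auto
    finally show ?case using i degree_smult_le order.trans by (auto simp: algebra_simps)
  qed (simp add: I_def)
  have van: "int p dvd poly ((pderiv ^^ k) F) x" if x: "x \<in> S" and k: "k < A" for x k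
  proof -
    obtain s t where st: "shift_class p n x = (s, t)" "(s, t) \<in> K" using x by (cases "shift_class p n x") (auto simp: S_def)
    have s: "[x ^ n = s] (mod int p)" and t: "[(1 - x) ^ n = t] (mod int p)"
      using st by (auto simp: shift_class_def cong_def)
    have "x ^ k * (1 - x) ^ k * poly ((pderiv ^^ k) F) x
        = poly (X ^ k * Y ^ k * (pderiv ^^ k) F) x" by (simp add: X_def Y_def poly_power)
    also have "X ^ k * Y ^ k * (pderiv ^^ k) F =
       (\<Sum>(c, a, b)\<in>I. smult (l (c, a, b)) (X ^ (n * b) * Y ^ (n * c) * U a b c k))"
    proof -
      have "(pderiv ^^ k) (\<Sum>i\<in>I. g i) = (\<Sum>i\<in>I. (pderiv ^^ k) (g i))" for g :: "_ \<Rightarrow> int poly"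
        by (induction k) (simp_all add: pderiv_sum_distrib)
      moreover have "(pderiv ^^ k) (smult d g) = smult d ((pderiv ^^ k) g)" for d and g :: "int poly"
        by (induction k) (simp_all add: pderiv_smult)
      ultimately show ?thesis unfolding F_def
        by (simp add: sum_distrib_left case_prod_unfold U(2)[symmetric])
    qed
    also have "poly \<dots> x = (\<Sum>(c, a, b)\<in>I. l (c, a, b) * ((x ^ n) ^ b * ((1 - x) ^ n) ^ c * poly (U a b c k) x))"
      by (simp add: poly_sum case_prod_unfold X_def Y_def poly_power power_mult mult.assoc)
    finally have 1: "x ^ k * (1 - x) ^ k * poly ((pderiv ^^ k) F) x =
       (\<Sum>(c, a, b)\<in>I. l (c, a, b) * ((x ^ n) ^ b * ((1 - x) ^ n) ^ c * poly (U a b c k) x))" .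
    have 2: "[(\<Sum>(c, a, b)\<in>I. l (c, a, b) * ((x ^ n) ^ b * ((1 - x) ^ n) ^ c * poly (U a b c k) x)) =
       (\<Sum>(c, a, b)\<in>I. l (c, a, b) * (s ^ b * t ^ c * poly (U a b c k) x))] (mod int p)"
      by (intro cong_sum) (auto intro!: cong_mult cong_pow s t)
    have "(\<Sum>(c, a, b)\<in>I. l (c, a, b) * (s ^ b * t ^ c * poly (U a b c k) x)) =
        (\<Sum>i\<in>I. \<Sum>j<2*A. x ^ j * (l i * w i ((s, t), k, j)))"
    proof (rule sum.cong[OF refl])
      fix i assume "i \<in> I"
      then obtain a b c where i: "i = (c, a, b)" "a < A" "b < B" "c < B" by (auto simp: I_def)
      have "poly (U a b c k) x = (\<Sum>j<2*A. coeff (U a b c k) j * x ^ j)"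
        unfolding poly_altdef using U(1)[of a b c k] i k
        by (intro sum.mono_neutral_left) (auto simp: coeff_eq_0)
      then show "(case i of (c, a, b) \<Rightarrow> l (c, a, b) * (s ^ b * t ^ c * poly (U a b c k) x)) =
         (\<Sum>j<2*A. x ^ j * (l i * w i ((s, t), k, j)))"
        unfolding i by (simp add: w_def sum_distrib_left algebra_simps)
    qed
    also have "\<dots> = (\<Sum>j<2*A. x ^ j * (\<Sum>i\<in>I. l i * w i ((s, t), k, j)))"
      unfolding sum_distrib_left by (rule sum.swap)
    also have "int p dvd \<dots>"
    proof (rule dvd_sum, rule dvd_mult)
      fix j assume "j \<in> {..<2 * A}"
      then have "((s, t), k, j) \<in> J" using st k by (simp add: J_def)
      then show "int p dvd (\<Sum>i\<in>I. l i * w i ((s, t), k, j))" using l(2) by blast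
    qed
    finally have "int p dvd x ^ k * (1 - x) ^ k * poly ((pderiv ^^ k) F) x"
      unfolding 1 cong_dvd_iff[OF 2] .
    \<comment> \<open>This is where the residues 0 and 1 must be absent: the prefactor introduced to
      clear the derivative can be cancelled.\<close>
    moreover have "\<not> int p dvd x" "\<not> int p dvd 1 - x"
      using x zdvd_imp_le[of "int p" x] zdvd_imp_le[of "int p" "x - 1"]
      by (auto simp: S_def dvd_diff_commute[of _ 1 x])
    ultimately show ?thesis
      using prime_dvd_mult_iff[OF pp] prime_dvd_power[OF pp, of x k] prime_dvd_power[OF pp, of "1 - x" k] by blast
  qed
  have finS: "finite S" unfolding S_def by (rule finite_subset[of _ "{2..<int p}"]) auto
  have "(\<Sum>x\<in>S. A) \<le> degree F"
  proof (rule sum_root_multiplicity_mod_le_degree[OF p _ _ nF])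
    show "x = y" if "x \<in> S" "y \<in> S" "int p dvd x - y" for x y
    proof -
      have "x mod int p = y mod int p" using that by (simp add: mod_eq_dvd_iff)
      then show ?thesis using that by (auto simp: S_def)
    qed
  qed (use van Ap finS in auto)
  then have "card S * A \<le> 2 * n * B" using degF by simp
  also have "\<dots> \<le> 2 * (2 * (A * B)) * B" using nAB by (intro mult_le_mono) auto
  also have "\<dots> = (4 * B ^ 2) * A" by (simp add: power2_eq_square)
  finally show ?thesis using A by (simp add: S_def)
qed

section \<open>Counting large shift classes\<close>

definition shift_class_size :: "nat \<Rightarrow> nat \<Rightarrow> int \<times> int \<Rightarrow> nat" where
  "shift_class_size p n k = card {x \<in> {2..<int p}. shift_class p n x = k}"

lemma finite_residues_Collect [simp]: "finite {x \<in> {a..<b :: int}. Q x}"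
  by (rule finite_subset[of _ "{a..<b}"]) auto

lemma sum_shift_class_size:
  assumes "finite K"
  shows "(\<Sum>k\<in>K. shift_class_size p n k) = card {x \<in> {2..<int p}. shift_class p n x \<in> K}"
proof -
  have "{x \<in> {2..<int p}. shift_class p n x \<in> K} = (\<Union>k\<in>K. {x \<in> {2..<int p}. shift_class p n x = k})"
    by auto
  also have "card \<dots> = (\<Sum>k\<in>K. shift_class_size p n k)"
    unfolding shift_class_size_def by (intro card_UN_disjoint ballI impI finite_residues_Collect assms) auto
  finally show ?thesis by simp
qed

lemma card_power_roots_mod_le:
  fixes p n :: nat
  assumes p: "prime p" and n: "n > 0" and S: "S \<subseteq> {0..<int p}" "\<And>x. x \<in> S \<Longrightarrow> x ^ n mod int p = a mod int p"
  shows "card S \<le> n"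
proof -
  define f where "f = monom 1 n + [:- a:]"
  have d: "degree f = n" unfolding f_def using n by (subst degree_add_eq_left) (auto simp: degree_monom_eq)
  have nf: "\<not> [:int p:] dvd f"
  proof
    assume "[:int p:] dvd f"
    then have "int p dvd coeff f n" by (simp only: const_poly_dvd_iff)
    then have "int p dvd 1" using n by (simp add: f_def coeff_pCons split: nat.splits)
    then show False using p prime_gt_1_nat[OF p] by simp
  qed
  have "(\<Sum>x\<in>S. 1) \<le> degree f"
  proof (rule sum_root_multiplicity_mod_le_degree[OF p _ _ nf])
    show "finite S" using S finite_subset by blast
    show "x = y" if "x \<in> S" "y \<in> S" "int p dvd x - y" for x y
    proof -
      have "x mod int p = y mod int p" using that by (simp add: mod_eq_dvd_iff)
      moreover have "x mod int p = x" "y mod int p = y" using that S by auto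
      ultimately show ?thesis by simp
    qed
    show "1 \<le> p" using prime_gt_0_nat[OF p] by simp
    show "int p dvd poly ((pderiv ^^ k) f) x" if "x \<in> S" "k < 1" for x k
      using S(2)[OF that(1)] that by (simp add: f_def poly_monom mod_eq_dvd_iff)
  qed
  then show ?thesis by (simp add: d)
qed

lemma shift_class_size_le:
  assumes "prime p" "n > 0"
  shows "shift_class_size p n k \<le> n"
  unfolding shift_class_size_def
  by (rule card_power_roots_mod_le[OF assms, where a = "fst k"]) (auto simp: shift_class_def)

lemma finite_rich_shift_classes:
  assumes "v > 0" shows "finite {k. v \<le> shift_class_size p n k}"
proof -
  have "{k. v \<le> shift_class_size p n k} \<subseteq> shift_class p n ` {2..<int p}"
  proof
    fix k assume "k \<in> {k. v \<le> shift_class_size p n k}"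
    then have "card {x \<in> {2..<int p}. shift_class p n x = k} \<noteq> 0" using assms by (simp add: shift_class_size_def)
    then have "{x \<in> {2..<int p}. shift_class p n x = k} \<noteq> {}" by (metis card.empty)
    then show "k \<in> shift_class p n ` {2..<int p}" by auto
  qed
  then show ?thesis by (rule finite_subset) simp
qed

text \<open>Optimises the Stepanov bound with \<open>B\<close> about \<open>64 * n / v\<close>. Any
  \<open>N\<close> classes of size at least \<open>v\<close> with \<open>N * v > 4 * B^2\<close>
  would contradict it, so there are at most \<open>4 * B^2 / v\<close> of them;
  \<open>16384 = 4 * 64^2\<close>. The hypothesis on \<open>v\<close> gives
  \<open>n * B <= p\<close>, and with \<open>p <= n^2\<close> also \<open>v >= 64\<close>, hence
  \<open>B <= n\<close>.\<close>

lemma card_rich_shift_classes: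
  fixes p n v :: nat
  assumes p: "prime p" and n: "p \<le> n ^ 2" "n ^ 3 \<le> p ^ 2" and v: "64 * n ^ 2 \<le> v * p"
  shows "card {k. v \<le> shift_class_size p n k} * v ^ 3 \<le> 16384 * n ^ 2"
proof (cases "{k. v \<le> shift_class_size p n k} = {}")
  case True
  then show ?thesis by (simp only: card.empty)
next
  case False
  define R where "R = {k. v \<le> shift_class_size p n k}"
  have p0: "p > 0" using p prime_gt_0_nat by blast
  have n0: "n > 0" using n p0 by (cases n) auto
  have v64: "v \<ge> 64"
  proof -
    have "64 * n ^ 2 \<le> v * n ^ 2" using v n mult_le_mono2 order.trans by blast
    then show ?thesis using n0 by simp
  qed
  have finR: "finite R" unfolding R_def using v64 by (intro finite_rich_shift_classes) simp
  from False obtain k0 where k0: "k0 \<in> R" by (auto simp: R_def)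
  have vn: "v \<le> n" using k0 shift_class_size_le[OF p n0, of k0] by (simp add: R_def)
  have *: "card K * v \<le> 4 * B ^ 2" if "K \<subseteq> R" "0 < B" "B \<le> n" "n * B \<le> p" "2 * card K * n < B ^ 3" for K B
  proof -
    have finK: "finite K" using that finR finite_subset by blast
    have "card K * v = (\<Sum>k\<in>K. v)" by simp
    also have "\<dots> \<le> (\<Sum>k\<in>K. shift_class_size p n k)" using that by (intro sum_mono) (auto simp: R_def)
    also have "\<dots> = card {x \<in> {2..<int p}. shift_class p n x \<in> K}" by (rule sum_shift_class_size[OF finK])
    also have "\<dots> \<le> 4 * B ^ 2" using stepanov_shift_class_bound[OF p] that finK by blast
    finally show ?thesis .
  qed
  show ?thesis
  proof (cases "v ^ 3 \<le> 65536 * n ^ 2")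
    case True
    define B where "B = 64 * n div v"
    have Bv: "B * v \<le> 64 * n" by (simp add: B_def)
    have "64 * n < B * v + v" using v64 unfolding B_def
      by (metis add.commute dividend_less_times_div mult.commute mult_Suc gr0I not_numeral_le_zero)
    then have Bv2: "63 * n \<le> B * v" using vn by linarith
    have B0: "B > 0" using Bv2 n0 by (cases B) auto
    have Bn: "B \<le> n"
    proof -
      have "B * 64 \<le> B * v" using v64 by simp
      then show ?thesis using Bv by linarith
    qed
    have "v * (n * B) \<le> v * p"
    proof -
      have "v * (n * B) = n * (B * v)" by simp
      also have "\<dots> \<le> n * (64 * n)" using Bv by (rule mult_le_mono2)
      also have "\<dots> = 64 * n ^ 2" by (simp add: power2_eq_square)
      finally show ?thesis using v by (rule order.trans)
    qed
    then have nB: "n * B \<le> p" using v64 by simp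
    define N where "N = 4 * B ^ 2 div v + 1"
    have Nv: "4 * B ^ 2 < N * v" using v64 unfolding N_def
      by (metis Suc_eq_plus1 dividend_less_times_div mult.commute mult_Suc_right zero_less_numeral order_less_le_trans)
    have Nv2: "N * v \<le> 4 * B ^ 2 + v" unfolding N_def by (simp add: algebra_simps)
    have NB: "2 * N * n < B ^ 3"
    proof -
      \<comment> \<open>The case assumption enters here: the rounding \<open>+ 1\<close> in
        \<open>N\<close> costs \<open>2 * v\<close>, and \<open>63 = 8 + 55\<close> leaves room for
        it.\<close>
      have "2 * v * v ^ 2 < 55 * B ^ 2 * v ^ 2"
      proof -
        have "(63 * n) ^ 2 \<le> (B * v) ^ 2" using Bv2 by (intro power_mono) auto
        then have "3969 * n ^ 2 \<le> B ^ 2 * v ^ 2" by (simp add: power_mult_distrib)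
        moreover have "2 * v * v ^ 2 = 2 * v ^ 3" by (simp add: power2_eq_square power3_eq_cube)
        moreover have "n ^ 2 > 0" using n0 by simp
        ultimately show ?thesis using True by linarith
      qed
      then have v55: "2 * v < 55 * B ^ 2" by (simp only: mult_less_cancel2)
      have "(2 * N * n) * v = 2 * n * (N * v)" by simp
      also have "\<dots> \<le> 2 * n * (4 * B ^ 2 + v)" using Nv2 by simp
      also have "\<dots> = n * (8 * B ^ 2 + 2 * v)" by (simp add: algebra_simps)
      also have "\<dots> < n * (63 * B ^ 2)" using v55 n0 by simp
      also have "\<dots> = (63 * n) * B ^ 2" by simp
      also have "\<dots> \<le> (B * v) * B ^ 2" using Bv2 by (rule mult_le_mono1)
      also have "\<dots> = B ^ 3 * v" by (simp add: power2_eq_square power3_eq_cube)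
      finally show ?thesis by (simp only: mult_less_cancel2)
    qed
    have "card R < N"
    proof (rule ccontr)
      assume "\<not> card R < N"
      then obtain K where K: "K \<subseteq> R" "card K = N" by (meson not_less obtain_subset_with_card_n)
      have "N * v \<le> 4 * B ^ 2" using *[OF K(1) B0 Bn nB] NB K(2) by simp
      then show False using Nv by simp
    qed
    then have "card R \<le> 4 * B ^ 2 div v" by (simp add: N_def)
    then have "card R * v \<le> 4 * B ^ 2" by (meson div_times_less_eq_dividend mult_le_mono1 order.trans)
    then have "card R * v * v ^ 2 \<le> 4 * B ^ 2 * v ^ 2" by (rule mult_le_mono1)
    also have "\<dots> = 4 * (B * v) ^ 2" by (simp add: power_mult_distrib)
    also have "\<dots> \<le> 4 * (64 * n) ^ 2" using Bv by (intro mult_le_mono2 power_mono) auto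
    finally show ?thesis by (simp add: R_def power_mult_distrib power3_eq_cube power2_eq_square mult.assoc)
  next
    case False
    \<comment> \<open>The least \<open>B\<close> admissible for a single class. Minimality gives
      \<open>B ^ 3 <= 16 * n\<close>, so one class of size \<open>v\<close> already forces
      \<open>v ^ 3 <= 16384 * n ^ 2\<close>, against the case assumption.\<close>
    define B where "B = (LEAST B. 2 * n < B ^ 3)"
    have ex: "2 * n < (2 * n + 1) ^ 3" by (rule order.strict_trans2[of _ "2*n+1"]) (use power_increasing[of 1 3 "2*n+1"] in auto)
    have B: "2 * n < B ^ 3" unfolding B_def by (rule LeastI[of _ "2*n+1"]) (rule ex)
    have B2: "B \<ge> 2"
    proof (rule ccontr)
      assume "\<not> ?thesis"
      then have "B \<le> 1" by simp
      then have "B ^ 3 \<le> 1 ^ 3" by (intro power_mono) auto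
      then show False using B n0 by simp
    qed
    have "\<not> 2 * n < (B - 1) ^ 3" using B2 unfolding B_def by (intro not_less_Least) simp
    moreover have "B ^ 3 \<le> (2 * (B - 1)) ^ 3" using B2 by (intro power_mono) auto
    ultimately have B16: "B ^ 3 \<le> 16 * n" by (simp add: power_mult_distrib)
    have p64: "64 * n \<le> p"
    proof -
      have "n * (64 * n) = 64 * n ^ 2" by (simp add: power2_eq_square)
      also have "\<dots> \<le> n * p" using v mult_le_mono1[OF vn, of p] by (rule order.trans)
      finally have "n * (64 * n) \<le> n * p" .
      then show ?thesis using n0 by simp
    qed
    have Bn: "B \<le> n"
    proof -
      have "B ^ 3 \<le> n ^ 3"
      proof -
        have "16 \<le> n * n" using v64 vn mult_le_mono[of 64 n 64 n] by simp
        then have "16 * n \<le> n * n * n" by (rule mult_le_mono1)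
        then show ?thesis using B16 unfolding power3_eq_cube[of n] by linarith
      qed
      then show ?thesis by (simp only: power_mono_iff zero_le zero_less_numeral)
    qed
    have nB: "n * B \<le> p"
    proof -
      \<comment> \<open>For this \<open>B\<close> the constraint \<open>n * B <= p\<close> rests on
        \<open>n ^ 3 <= p ^ 2\<close>.\<close>
      have "(n * B) ^ 3 \<le> n ^ 3 * (16 * n)" using B16 by (simp add: power_mult_distrib)
      also have "\<dots> \<le> p ^ 2 * p" using p64 n by (intro mult_le_mono) auto
      also have "\<dots> = p ^ 3" by (simp add: power2_eq_square power3_eq_cube)
      finally show ?thesis by (simp only: power_mono_iff zero_le zero_less_numeral)
    qed
    have "card {k0} * v \<le> 4 * B ^ 2" using *[of "{k0}" B] k0 B2 Bn nB B by simp
    then have "v ^ 3 \<le> (4 * B ^ 2) ^ 3" by (intro power_mono) auto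
    also have "\<dots> = 64 * (B ^ 3) ^ 2" by (simp add: power_mult_distrib flip: power_mult)
    also have "\<dots> \<le> 64 * (16 * n) ^ 2" using B16 by (intro mult_le_mono2 power_mono) auto
    finally show ?thesis using False by (simp add: power_mult_distrib)
  qed
qed

text \<open>Roughly \<open>n\<^sup>2 / p\<close>, the size below which the Stepanov bound says nothing.\<close>

definition heavy_threshold :: "nat \<Rightarrow> nat \<Rightarrow> nat" where
  "heavy_threshold p n = 64 * n ^ 2 div p + 1"

definition harmonic_sum :: "nat \<Rightarrow> real" where
  "harmonic_sum n = (\<Sum>v=1..n. 1 / real v)"

lemma power3_le_sum: "real N ^ 3 \<le> (\<Sum>v=1..N. 3 * real v ^ 2)"
proof (induction N)
  case (Suc N)
  have "real (Suc N) ^ 3 \<le> real N ^ 3 + 3 * real (Suc N) ^ 2"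
    by (simp add: power3_eq_cube power2_eq_square algebra_simps)
  then show ?case using Suc by simp
qed simp

lemma sum_cube_heavy_shift_classes:
  fixes p n :: nat
  assumes p: "prime p" and n: "p \<le> n ^ 2" "n ^ 3 \<le> p ^ 2"
  shows "(\<Sum>k | heavy_threshold p n \<le> shift_class_size p n k. real (shift_class_size p n k) ^ 3)
           \<le> 49152 * real n ^ 2 * harmonic_sum n"
proof -
  define N where "N = shift_class_size p n"
  define v0 where "v0 = heavy_threshold p n"
  have p0: "p > 0" using p prime_gt_0_nat by blast
  have n0: "n > 0" using n p0 by (cases n) auto
  have v0: "v0 > 0" "64 * n ^ 2 \<le> v0 * p"
    using dividend_less_times_div[OF p0, of "64 * n ^ 2"]
    by (simp_all add: v0_def heavy_threshold_def algebra_simps)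
  have fin: "finite {k. v0 \<le> N k}" unfolding N_def using v0 by (intro finite_rich_shift_classes)
  have "(\<Sum>k | v0 \<le> N k. real (N k) ^ 3) \<le> (\<Sum>k | v0 \<le> N k. \<Sum>v=1..n. 3 * real v ^ 2 * of_bool (v \<le> N k))"
  proof (rule sum_mono)
    fix k
    have "N k \<le> n" unfolding N_def by (rule shift_class_size_le[OF p n0])
    then have "(\<Sum>v=1..N k. 3 * real v ^ 2) = (\<Sum>v=1..n. 3 * real v ^ 2 * of_bool (v \<le> N k))"
      by (intro sum.mono_neutral_cong_left) auto
    then show "real (N k) ^ 3 \<le> (\<Sum>v=1..n. 3 * real v ^ 2 * of_bool (v \<le> N k))" using power3_le_sum[of "N k"] by simp
  qed
  also have "\<dots> = (\<Sum>v=1..n. 3 * real v ^ 2 * (\<Sum>k | v0 \<le> N k. of_bool (v \<le> N k)))"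
    unfolding sum_distrib_left by (rule sum.swap)
  also have "\<dots> \<le> (\<Sum>v=1..n. 49152 * real n ^ 2 * (1 / real v))"
  proof (rule sum_mono)
    fix v assume v: "v \<in> {1..n}"
    \<comment> \<open>Below the threshold the count is taken at \<open>v0\<close> instead; since the
      sum runs over heavy classes only, nothing is lost. Each level then contributes
      \<open>3 * 16384 * n^2 / v\<close>.\<close>
    define u where "u = max v v0"
    have "{k. v0 \<le> N k} \<inter> {k. v \<le> N k} = {k. u \<le> N k}" by (auto simp: u_def)
    then have c: "(\<Sum>k | v0 \<le> N k. of_bool (v \<le> N k)) = real (card {k. u \<le> N k})"
      using fin by (simp add: of_bool_def sum.If_cases)
    have "64 * n ^ 2 \<le> u * p" using v0 mult_le_mono1[of v0 u p] unfolding u_def by linarith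
    then have "card {k. u \<le> N k} * u ^ 3 \<le> 16384 * n ^ 2"
      unfolding N_def by (rule card_rich_shift_classes[OF p n])
    moreover have "v ^ 3 \<le> u ^ 3" by (intro power_mono) (auto simp: u_def)
    ultimately have "card {k. u \<le> N k} * v ^ 3 \<le> 16384 * n ^ 2"
      using mult_le_mono2 order.trans by blast
    then have "real (card {k. u \<le> N k} * v ^ 3) \<le> real (16384 * n ^ 2)"
      by (simp only: of_nat_le_iff)
    then have "real (card {k. u \<le> N k}) * real v ^ 3 \<le> 16384 * real n ^ 2" by simp
    then show "3 * real v ^ 2 * (\<Sum>k | v0 \<le> N k. of_bool (v \<le> N k)) \<le> 49152 * real n ^ 2 * (1 / real v)"
      unfolding c using v by (simp add: field_simps power3_eq_cube power2_eq_square)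
  qed
  also have "\<dots> = 49152 * real n ^ 2 * harmonic_sum n" by (simp add: harmonic_sum_def sum_distrib_left)
  finally show ?thesis by (simp add: N_def v0_def)
qed

lemma shift_class_mod [simp]: "shift_class p n (x mod int p) = shift_class p n x"
proof -
  have "(1 - x mod int p) ^ n mod int p = (1 - x) ^ n mod int p" by (metis mod_diff_right_eq power_mod)
  then show ?thesis by (simp add: shift_class_def power_mod)
qed

lemma card_image_mult_le:
  assumes "finite S" and "\<And>y. y \<in> f ` S \<Longrightarrow> m \<le> card {x \<in> S. f x = y}"
  shows "m * card (f ` S) \<le> card S"
proof -
  have "m * card (f ` S) = (\<Sum>y\<in>f ` S. m)" by simp
  also have "\<dots> \<le> (\<Sum>y\<in>f ` S. card {x \<in> S. f x = y})" using assms by (intro sum_mono)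
  also have "\<dots> = card S" using sum.image_gen[OF assms(1), of "\<lambda>_. 1::nat" f] by simp
  finally show ?thesis .
qed

section \<open>Differences of a subgroup\<close>

text \<open>Membership in the subgroup is a power congruence, and the size hypotheses are cleared of
  real exponents. \<open>subgroup_units_residue_ring\<close> shows that every subgroup of the units
  has this form.\<close>

locale residue_subgroup =
  fixes p n :: nat and G :: "int set"
  assumes prime_p: "prime p" and lower: "p \<le> n ^ 2" and upper: "n ^ 3 \<le> p ^ 2"
    and G_eq: "G = {u \<in> {0..<int p}. [u ^ n = 1] (mod int p)}"
    and card_G: "card G = n"
begin

abbreviation "F \<equiv> {0..<int p}"

text \<open>Membership in \<open>G\<close> for integers that need not be reduced, so that sums and
  products can be tested directly.\<close>

definition unit_root :: "int \<Rightarrow> bool" where "unit_root u \<longleftrightarrow> [u ^ n = 1] (mod int p)"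

definition minv :: "int \<Rightarrow> int" where "minv d = (SOME x. [d * x = 1] (mod int p))"

definition rep :: "int \<Rightarrow> nat" where "rep d = card {y \<in> G. unit_root (y + d)}"

lemma prime_int: "prime (int p)" using prime_p by simp

lemma p_gt_1: "p > 1" using prime_p prime_gt_1_nat by blast

lemma n_pos: "n > 0" using lower p_gt_1 by (cases n) auto

lemma finite_G [simp]: "finite G" unfolding G_eq by (rule finite_residues_Collect)

lemma G_iff: "u \<in> G \<longleftrightarrow> u \<in> F \<and> unit_root u" by (auto simp: G_eq unit_root_def)

lemma root_mod [simp]: "unit_root (u mod int p) \<longleftrightarrow> unit_root u"
  by (simp add: unit_root_def cong_def power_mod)

lemma root_cong: "[u = v] (mod int p) \<Longrightarrow> unit_root u \<longleftrightarrow> unit_root v"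
  by (metis cong_def root_mod)

lemma mod_in_F [simp]: "u mod int p \<in> F" using p_gt_1 by simp

lemma mod_in_G: "u mod int p \<in> G \<longleftrightarrow> unit_root u" by (simp only: G_iff mod_in_F root_mod) simp

lemma root_mult: "unit_root u \<Longrightarrow> unit_root v \<Longrightarrow> unit_root (u * v)"
  unfolding unit_root_def power_mult_distrib using cong_mult[of "u ^ n" 1 "int p" "v ^ n" 1] by simp

lemma root_not_dvd: "unit_root u \<Longrightarrow> \<not> int p dvd u"
proof
  assume "unit_root u" "int p dvd u"
  then have "int p dvd u ^ n" using n_pos by (simp add: dvd_power_same dvd_trans dvd_power)
  then have "int p dvd 1" using \<open>unit_root u\<close> cong_dvd_iff unfolding unit_root_def by blast
  then show False using p_gt_1 by simp
qed

lemma minv: "\<not> int p dvd d \<Longrightarrow> [d * minv d = 1] (mod int p)"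
proof -
  assume "\<not> int p dvd d"
  then have "coprime d (int p)" using prime_imp_coprime[OF prime_int] by (simp add: coprime_commute)
  then have "\<exists>x. [d * x = 1] (mod int p)" by (rule cong_solve_coprime_int)
  then show ?thesis unfolding minv_def by (rule someI_ex)
qed

lemma minv_mod [simp]: "minv (d mod int p) = minv d"
  unfolding minv_def by (simp add: cong_def mod_mult_left_eq)

lemma minv_cong: "[d = e] (mod int p) \<Longrightarrow> minv d = minv e"
  by (metis cong_def minv_mod)

lemma minv_not_dvd: "\<not> int p dvd d \<Longrightarrow> \<not> int p dvd minv d"
proof
  assume "\<not> int p dvd d" "int p dvd minv d"
  then have "int p dvd d * minv d" by simp
  then have "int p dvd 1" using minv[OF \<open>\<not> int p dvd d\<close>] cong_dvd_iff by blast
  then show False using p_gt_1 by simp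
qed

lemma mult_not_dvd: "\<not> int p dvd a \<Longrightarrow> \<not> int p dvd b \<Longrightarrow> \<not> int p dvd a * b"
  using prime_dvd_mult_iff[OF prime_int] by blast

lemma cancel_unit: "\<not> int p dvd c \<Longrightarrow> [c * a = c * b] (mod int p) \<Longrightarrow> [a = b] (mod int p)"
proof -
  assume c: "\<not> int p dvd c" and "[c * a = c * b] (mod int p)"
  then have "int p dvd c * (a - b)" by (simp add: cong_iff_dvd_diff algebra_simps)
  then have "int p dvd a - b" using c prime_dvd_mult_iff[OF prime_int] by blast
  then show ?thesis by (simp add: cong_iff_dvd_diff)
qed

lemma F_cong_eq: "a \<in> F \<Longrightarrow> b \<in> F \<Longrightarrow> [a = b] (mod int p) \<Longrightarrow> a = b"
  by (simp add: cong_def)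

lemma root_minv: "unit_root u \<Longrightarrow> unit_root (minv u)"
proof -
  assume u: "unit_root u"
  have "[(u * minv u) ^ n = 1 ^ n] (mod int p)" using minv[OF root_not_dvd[OF u]] by (rule cong_pow)
  then have 1: "[u ^ n * minv u ^ n = 1] (mod int p)" by (simp add: power_mult_distrib)
  have 2: "[u ^ n * minv u ^ n = 1 * minv u ^ n] (mod int p)"
    using u unfolding unit_root_def by (rule cong_mult) simp
  show ?thesis unfolding unit_root_def using cong_trans[OF cong_sym[OF 2] 1] by simp
qed

lemma bij_mult_F:
  assumes "\<not> int p dvd u" shows "bij_betw (\<lambda>y. (u * y) mod int p) F F"
proof -
  have inj: "inj_on (\<lambda>y. (u * y) mod int p) F"
    by (rule inj_onI) (rule F_cong_eq, assumption, assumption, rule cancel_unit[OF assms], simp only: cong_def)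
  moreover have "(\<lambda>y. (u * y) mod int p) ` F \<subseteq> F" by (auto simp del: atLeastLessThan_iff)
  ultimately show ?thesis unfolding bij_betw_def using endo_inj_surj[of F] by simp
qed

lemma bij_mult_G:
  assumes "unit_root u" shows "bij_betw (\<lambda>y. (u * y) mod int p) G G"
proof -
  have inj: "inj_on (\<lambda>y. (u * y) mod int p) G"
    using bij_mult_F[OF root_not_dvd[OF assms]] unfolding bij_betw_def
    by (rule inj_on_subset[OF conjunct1]) (auto simp: G_iff)
  moreover have "(\<lambda>y. (u * y) mod int p) ` G \<subseteq> G"
    using assms by (auto simp: mod_in_G intro!: root_mult) (simp add: G_iff)
  ultimately show ?thesis unfolding bij_betw_def using endo_inj_surj[OF finite_G] by simp
qed

lemma bij_add_F: "bij_betw (\<lambda>d. (y + d) mod int p) F F"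
proof -
  have inj: "inj_on (\<lambda>d. (y + d) mod int p) F"
    by (rule inj_onI) (rule F_cong_eq, assumption, assumption, metis cong_add_lcancel cong_def)
  moreover have "(\<lambda>d. (y + d) mod int p) ` F \<subseteq> F" by (auto simp del: atLeastLessThan_iff)
  ultimately show ?thesis unfolding bij_betw_def using endo_inj_surj[of F] by simp
qed

lemma rep_mod [simp]: "rep (d mod int p) = rep d"
proof -
  have "unit_root (y + d mod int p) \<longleftrightarrow> unit_root (y + d)" for y by (rule root_cong) (simp add: cong_def mod_add_right_eq)
  then show ?thesis by (simp add: rep_def)
qed

lemma rep_cong: "[d = e] (mod int p) \<Longrightarrow> rep d = rep e"
  by (metis cong_def rep_mod)

lemma rep_eq_sum: "real (rep d) = (\<Sum>y\<in>G. of_bool (unit_root (y + d)))"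
  by (simp add: rep_def of_bool_def sum.If_cases Int_def)

lemma rep_le: "rep d \<le> n"
  using card_mono[OF finite_G, of "{y \<in> G. unit_root (y + d)}"] by (auto simp: rep_def card_G)

lemma rep_dvd: "int p dvd d \<Longrightarrow> rep d = n"
proof -
  assume "int p dvd d"
  then have "unit_root (y + d) \<longleftrightarrow> unit_root y" for y by (intro root_cong) (simp add: cong_iff_dvd_diff)
  then have "{y \<in> G. unit_root (y + d)} = G" using G_iff by blast
  then show ?thesis by (simp add: rep_def card_G)
qed

lemma rep_scale: "unit_root u \<Longrightarrow> rep (u * d) = rep d"
proof -
  assume u: "unit_root u"
  have "bij_betw (\<lambda>y. (u * y) mod int p) {y \<in> G. unit_root (y + d)} {y \<in> G. unit_root (y + u * d)}"
  proof (rule bij_betw_Collect[OF bij_mult_G[OF u]])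
    fix y
    have "unit_root ((u * y) mod int p + u * d) \<longleftrightarrow> unit_root (u * (y + d))"
      by (rule root_cong) (simp add: cong_def mod_add_left_eq distrib_left)
    also have "\<dots> \<longleftrightarrow> unit_root (y + d)"
    proof
      assume "unit_root (u * (y + d))"
      then have "unit_root (minv u * (u * (y + d)))" using root_minv[OF u] root_mult by blast
      moreover have "[minv u * (u * (y + d)) = y + d] (mod int p)"
        using cong_mult[OF minv[OF root_not_dvd[OF u]] cong_refl, of "y + d"] by (simp add: algebra_simps)
      ultimately show "unit_root (y + d)" using root_cong by blast
    qed (use u root_mult in blast)
    finally show "unit_root ((u * y) mod int p + u * d) \<longleftrightarrow> unit_root (y + d)" .
  qed
  from bij_betw_same_card[OF this] show ?thesis by (simp add: rep_def)
qed

lemma sum_root_shift: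
  fixes h :: "int \<Rightarrow> real"
  assumes h: "\<And>d. h (d mod int p) = h d"
  shows "(\<Sum>d\<in>F. of_bool (unit_root (y + d)) * h d) = (\<Sum>u\<in>G. h (u - y))"
proof -
  have "(\<Sum>d\<in>F. of_bool (unit_root (y + d)) * h d) =
        (\<Sum>d\<in>F. (\<lambda>u. of_bool (unit_root u) * h (u - y)) ((y + d) mod int p))"
  proof (rule sum.cong[OF refl])
    fix d
    have "((y + d) mod int p - y) mod int p = d mod int p" by (simp add: mod_diff_left_eq)
    then have "h ((y + d) mod int p - y) = h d" by (metis h)
    then show "of_bool (unit_root (y + d)) * h d = (\<lambda>u. of_bool (unit_root u) * h (u - y)) ((y + d) mod int p)" by simp
  qed
  also have "\<dots> = (\<Sum>u\<in>F. of_bool (unit_root u) * h (u - y))"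
    using sum.reindex_bij_betw[OF bij_add_F[of y], of "\<lambda>u. of_bool (unit_root u) * h (u - y)"] by simp
  also have "\<dots> = (\<Sum>u\<in>G. h (u - y))"
    by (rule sum.mono_neutral_cong_right) (auto simp: G_iff)
  finally show ?thesis .
qed

text \<open>A sum weighted by \<open>rep\<close> is a sum over pairs from \<open>G\<close>, each
  \<open>d\<close> being \<open>u - y\<close> in \<open>rep d\<close> ways. Periodicity of
  \<open>h\<close> allows unreduced differences.\<close>

lemma sum_rep_mult:
  fixes h :: "int \<Rightarrow> real"
  assumes h: "\<And>d. h (d mod int p) = h d"
  shows "(\<Sum>d\<in>F. h d * real (rep d)) = (\<Sum>y\<in>G. \<Sum>u\<in>G. h (u - y))"
proof -
  have "(\<Sum>d\<in>F. h d * real (rep d)) = (\<Sum>d\<in>F. \<Sum>y\<in>G. of_bool (unit_root (y + d)) * h d)"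
    by (simp add: rep_eq_sum sum_distrib_left mult.commute)
  also have "\<dots> = (\<Sum>y\<in>G. \<Sum>d\<in>F. of_bool (unit_root (y + d)) * h d)" by (rule sum.swap)
  finally show ?thesis by (simp add: sum_root_shift[where h = h, OF h])
qed

lemma rep_diff: "real (rep (y - z)) = (\<Sum>w\<in>F. of_bool (unit_root (z + w)) * of_bool (unit_root (y + w)))"
proof -
  have "unit_root (y + d mod int p) \<longleftrightarrow> unit_root (y + d)" for d by (rule root_cong) (simp add: cong_def mod_add_right_eq)
  then show ?thesis
    by (subst sum_root_shift) (auto simp: rep_eq_sum algebra_simps)
qed

lemma sum_rep: "(\<Sum>d\<in>F. real (rep d)) = real n ^ 2"
  using sum_rep_mult[of "\<lambda>_. 1"] by (simp add: card_G power2_eq_square)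

section \<open>Moments of the representation function\<close>

definition rep_moment :: "nat \<Rightarrow> real" where "rep_moment k = (\<Sum>d\<in>F. real (rep d) ^ k)"

text \<open>The common shift class of all \<open>x = (y + d) / d\<close> with \<open>y\<close> and
  \<open>y + d\<close> in \<open>G\<close>, because \<open>1 - x = - y / d\<close> and elements of
  \<open>G\<close> have \<open>n\<close>-th power 1.\<close>

definition diff_class :: "int \<Rightarrow> int \<times> int" where
  "diff_class d = (minv d ^ n mod int p, (- minv d) ^ n mod int p)"

lemma shift_class_cong: "[a = b] (mod int p) \<Longrightarrow> shift_class p n a = shift_class p n b"
  by (metis cong_def shift_class_mod)

lemma shift_class_root_mult:
  assumes "[x = u * a] (mod int p)" "[1 - x = v * b] (mod int p)" "unit_root u" "unit_root v"
  shows "shift_class p n x = (a ^ n mod int p, b ^ n mod int p)"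
proof -
  have "[u ^ n * a ^ n = 1 * a ^ n] (mod int p)" "[v ^ n * b ^ n = 1 * b ^ n] (mod int p)"
    using assms(3,4) cong_mult[OF _ cong_refl] unfolding unit_root_def by blast+
  moreover have "[x ^ n = u ^ n * a ^ n] (mod int p)" "[(1 - x) ^ n = v ^ n * b ^ n] (mod int p)"
    unfolding power_mult_distrib[symmetric] using assms(1,2) cong_pow by blast+
  ultimately have "[x ^ n = 1 * a ^ n] (mod int p)" "[(1 - x) ^ n = 1 * b ^ n] (mod int p)"
    using cong_trans by blast+
  then show ?thesis by (simp add: shift_class_def cong_def)
qed

lemma residue_ge_2: "\<not> int p dvd x \<Longrightarrow> \<not> int p dvd 1 - x \<Longrightarrow> x mod int p \<in> {2..<int p}"
proof -
  assume x: "\<not> int p dvd x" "\<not> int p dvd 1 - x"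
  have "x mod int p \<noteq> 0" using x by (simp add: dvd_eq_mod_eq_0)
  moreover have "x mod int p \<noteq> 1"
  proof
    assume "x mod int p = 1"
    then have "1 mod int p = x mod int p" using p_gt_1 by simp
    then show False using x by (simp add: mod_eq_dvd_iff)
  qed
  moreover have "x mod int p \<in> F" by (rule mod_in_F)
  ultimately show ?thesis unfolding atLeastLessThan_iff by linarith
qed

lemma rep_le_shift_class_size:
  assumes d: "\<not> int p dvd d"
  shows "rep d \<le> shift_class_size p n (diff_class d)"
  unfolding rep_def shift_class_size_def
proof (rule card_inj_on_le[where f = "\<lambda>y. ((y + d) * minv d) mod int p"])
  show "inj_on (\<lambda>y. ((y + d) * minv d) mod int p) {y \<in> G. unit_root (y + d)}"
  proof (rule inj_onI)
    fix y z assume yz: "y \<in> {y \<in> G. unit_root (y + d)}" "z \<in> {y \<in> G. unit_root (y + d)}"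
      "((y + d) * minv d) mod int p = ((z + d) * minv d) mod int p"
    then have "[minv d * (y + d) = minv d * (z + d)] (mod int p)" by (simp add: cong_def mult.commute)
    then have "[y + d = z + d] (mod int p)" using cancel_unit[OF minv_not_dvd[OF d]] by blast
    then have "[y = z] (mod int p)" by (simp add: cong_add_rcancel)
    then show "y = z" using F_cong_eq yz by (auto simp: G_iff)
  qed
  show "(\<lambda>y. ((y + d) * minv d) mod int p) ` {y \<in> G. unit_root (y + d)} \<subseteq>
     {x \<in> {2..<int p}. shift_class p n x = diff_class d}"
  proof (rule image_subsetI)
    fix y assume y: "y \<in> {y \<in> G. unit_root (y + d)}"
    then have ry: "unit_root y" "unit_root (y + d)" by (auto simp: G_iff)
    have 1: "[1 - (y + d) * minv d = y * (- minv d)] (mod int p)"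
      using cong_diff[OF cong_sym[OF minv[OF d]] cong_refl, of "(y + d) * minv d"] by (simp add: algebra_simps)
    have "\<not> int p dvd y * (- minv d)"
      using mult_not_dvd[OF root_not_dvd[OF ry(1)], of "- minv d"] minv_not_dvd[OF d] by simp
    then have "\<not> int p dvd 1 - (y + d) * minv d" using cong_dvd_iff[OF 1] by blast
    moreover have "\<not> int p dvd (y + d) * minv d" using mult_not_dvd root_not_dvd ry minv_not_dvd d by blast
    moreover have "shift_class p n ((y + d) * minv d) = diff_class d"
      unfolding diff_class_def by (rule shift_class_root_mult[OF cong_refl 1 ry(2,1)])
    ultimately show "((y + d) * minv d) mod int p \<in> {x \<in> {2..<int p}. shift_class p n x = diff_class d}"
      using residue_ge_2 by simp
  qed
qed (rule finite_residues_Collect)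

text \<open>Equal classes force equal \<open>n\<close>-th powers, so the fibre lies in a single
  coset of \<open>G\<close>.\<close>

lemma card_diff_class_fibre: "card {d \<in> {1..<int p}. diff_class d = k} \<le> n"
proof (cases "{d \<in> {1..<int p}. diff_class d = k} = {}")
  case True
  then show ?thesis by (simp only: card.empty)
next
  case False
  then obtain e where e: "e \<in> {1..<int p}" "diff_class e = k" by blast
  have nd: "\<not> int p dvd d" if "d \<in> {1..<int p}" for d using that zdvd_not_zless by auto
  have "card {d \<in> {1..<int p}. diff_class d = k} \<le> card G"
  proof (rule card_inj_on_le[where f = "\<lambda>d. (minv e * d) mod int p"])
    have "inj_on (\<lambda>d. (minv e * d) mod int p) F"
      using bij_mult_F[OF minv_not_dvd[OF nd[OF e(1)]]] by (simp add: bij_betw_def)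
    then show "inj_on (\<lambda>d. (minv e * d) mod int p) {d \<in> {1..<int p}. diff_class d = k}"
      by (rule inj_on_subset) auto
    show "(\<lambda>d. (minv e * d) mod int p) ` {d \<in> {1..<int p}. diff_class d = k} \<subseteq> G"
    proof (rule image_subsetI)
      fix d assume d: "d \<in> {d \<in> {1..<int p}. diff_class d = k}"
      then have "[minv e ^ n = minv d ^ n] (mod int p)" using e by (auto simp: diff_class_def cong_def)
      then have "[minv e ^ n * d ^ n = minv d ^ n * d ^ n] (mod int p)" by (rule cong_mult) simp
      moreover have "[(d * minv d) ^ n = 1 ^ n] (mod int p)" using minv nd d by (intro cong_pow) auto
      ultimately have "unit_root (minv e * d)" unfolding unit_root_def power_mult_distrib
        by (metis cong_trans mult.commute power_one)
      then show "(minv e * d) mod int p \<in> G" by (simp only: mod_in_G)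
    qed
  qed simp
  then show ?thesis by (simp only: card_G)
qed

lemma harmonic_sum_ge_1: "harmonic_sum n \<ge> 1"
proof -
  have "(\<Sum>v\<in>{1}. 1 / real v) \<le> harmonic_sum n"
    unfolding harmonic_sum_def using n_pos by (intro sum_mono2) auto
  then show ?thesis by simp
qed

lemma heavy_threshold_mult_le: "heavy_threshold p n * p \<le> 65 * n ^ 2"
proof -
  have "heavy_threshold p n * p = 64 * n ^ 2 div p * p + p" by (simp add: heavy_threshold_def)
  then show ?thesis using lower div_times_less_eq_dividend[of "64 * n ^ 2" p] by linarith
qed

text \<open>Split according to whether the class of \<open>d\<close> is heavy. If not,
  \<open>rep d\<close> is below the threshold, and the total is at most
  \<open>65^2 * n^6 / p^2\<close>, which \<open>n^3 <= p^2\<close> turns into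
  \<open>4225 * n^3\<close>. Heavy classes are covered by their cube sum, each class serving at most
  \<open>n\<close> differences. The zero difference adds \<open>n^3\<close>.\<close>

lemma rep_moment_3_le: "rep_moment 3 \<le> 60000 * real n ^ 3 * harmonic_sum n"
proof -
  define v0 where "v0 = heavy_threshold p n"
  define N where "N = shift_class_size p n"
  define L where "L = harmonic_sum n"
  have nd: "\<not> int p dvd d" if "d \<in> {1..<int p}" for d using that zdvd_not_zless by auto
  have "F = insert 0 {1..<int p}" using p_gt_1 by auto
  then have "rep_moment 3 = real n ^ 3 + (\<Sum>d\<in>{1..<int p}. real (rep d) ^ 3)"
    by (simp add: rep_moment_def rep_dvd)
  also have "(\<Sum>d\<in>{1..<int p}. real (rep d) ^ 3) \<le>
      (\<Sum>d\<in>{1..<int p}. real v0 ^ 2 * real (rep d) + of_bool (v0 \<le> N (diff_class d)) * real (N (diff_class d)) ^ 3)"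
  proof (rule sum_mono)
    fix d assume "d \<in> {1..<int p}"
    then have r: "rep d \<le> N (diff_class d)" unfolding N_def by (intro rep_le_shift_class_size nd)
    show "real (rep d) ^ 3 \<le> real v0 ^ 2 * real (rep d) + of_bool (v0 \<le> N (diff_class d)) * real (N (diff_class d)) ^ 3"
    proof (cases "v0 \<le> N (diff_class d)")
      case True
      have "real (rep d) ^ 3 \<le> real (N (diff_class d)) ^ 3" using r by (intro power_mono) auto
      then show ?thesis using True by (simp add: add_increasing)
    next
      case False
      then have "real (rep d) ^ 2 \<le> real v0 ^ 2" using r by (intro power_mono) auto
      then have "real (rep d) ^ 2 * real (rep d) \<le> real v0 ^ 2 * real (rep d)" by (rule mult_right_mono) simp
      then show ?thesis using False by (simp add: power3_eq_cube power2_eq_square)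
    qed
  qed
  also have "\<dots> = real v0 ^ 2 * (\<Sum>d\<in>{1..<int p}. real (rep d)) +
      (\<Sum>d\<in>{1..<int p}. of_bool (v0 \<le> N (diff_class d)) * real (N (diff_class d)) ^ 3)"
    by (simp add: sum.distrib sum_distrib_left)
  also have "(\<Sum>d\<in>{1..<int p}. real (rep d)) \<le> real n ^ 2"
    unfolding sum_rep[symmetric] by (rule sum_mono2) auto
  also have "(\<Sum>d\<in>{1..<int p}. of_bool (v0 \<le> N (diff_class d)) * real (N (diff_class d)) ^ 3)
     \<le> real n * (49152 * real n ^ 2 * L)"
  proof -
    define D where "D = {d \<in> {1..<int p}. v0 \<le> N (diff_class d)}"
    have finD: "finite D" unfolding D_def by (rule finite_residues_Collect)
    have "(\<Sum>d\<in>{1..<int p}. of_bool (v0 \<le> N (diff_class d)) * real (N (diff_class d)) ^ 3)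
       = (\<Sum>d\<in>D. real (N (diff_class d)) ^ 3)"
      by (rule sum.mono_neutral_cong_right) (auto simp: D_def)
    also have "\<dots> = (\<Sum>k\<in>diff_class ` D. \<Sum>d\<in>{d \<in> D. diff_class d = k}. real (N (diff_class d)) ^ 3)"
      by (rule sum.image_gen[OF finD])
    also have "\<dots> = (\<Sum>k\<in>diff_class ` D. real (card {d \<in> D. diff_class d = k}) * real (N k) ^ 3)" by simp
    also have "\<dots> \<le> (\<Sum>k\<in>diff_class ` D. real n * real (N k) ^ 3)"
    proof (intro sum_mono mult_right_mono)
      fix k
      have "card {d \<in> D. diff_class d = k} \<le> card {d \<in> {1..<int p}. diff_class d = k}"
        by (rule card_mono[OF finite_residues_Collect]) (auto simp: D_def)
      then show "real (card {d \<in> D. diff_class d = k}) \<le> real n" using card_diff_class_fibre[of k] by simp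
    qed simp
    also have "\<dots> \<le> (\<Sum>k | v0 \<le> N k. real n * real (N k) ^ 3)"
      by (rule sum_mono2) (auto simp: D_def N_def v0_def heavy_threshold_def intro!: finite_rich_shift_classes)
    also have "\<dots> \<le> real n * (49152 * real n ^ 2 * L)"
      unfolding sum_distrib_left[symmetric] N_def v0_def L_def
      by (intro mult_left_mono sum_cube_heavy_shift_classes prime_p lower upper) simp
    finally show ?thesis .
  qed
  finally have "rep_moment 3 \<le> real n ^ 3 + (real v0 ^ 2 * real n ^ 2 + real n * (49152 * real n ^ 2 * L))"
    by (simp add: mult_left_mono)
  also have "real v0 ^ 2 * real n ^ 2 \<le> 4225 * real n ^ 3"
  proof -
    have "real (v0 * p) \<le> real (65 * n ^ 2)" using heavy_threshold_mult_le unfolding v0_def by (simp only: of_nat_le_iff)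
    then have "(real v0 * real p) ^ 2 \<le> (65 * real n ^ 2) ^ 2" by (intro power_mono) auto
    then have "real v0 ^ 2 * real p ^ 2 \<le> 4225 * real n ^ 4" by (simp add: power_mult_distrib flip: power_mult)
    moreover have "real (n ^ 3) \<le> real (p ^ 2)" using upper by (simp only: of_nat_le_iff)
    then have "real v0 ^ 2 * real n ^ 3 \<le> real v0 ^ 2 * real p ^ 2" by (intro mult_left_mono) auto
    ultimately have "real v0 ^ 2 * real n ^ 3 \<le> 4225 * real n ^ 4" by linarith
    moreover have "real v0 ^ 2 * real n ^ 3 = real n * (real v0 ^ 2 * real n ^ 2)"
      "4225 * real n ^ 4 = real n * (4225 * real n ^ 3)"
      by (simp_all add: power2_eq_square power3_eq_cube power4_eq_xxxx)
    ultimately have "real n * (real v0 ^ 2 * real n ^ 2) \<le> real n * (4225 * real n ^ 3)" by linarith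
    then show ?thesis using n_pos by simp
  qed
  also have "real n ^ 3 + (4225 * real n ^ 3 + real n * (49152 * real n ^ 2 * L)) =
      4226 * real n ^ 3 + 49152 * real n ^ 3 * L" by (simp add: power3_eq_cube power2_eq_square)
  also have "4226 * real n ^ 3 \<le> 4226 * real n ^ 3 * L" using harmonic_sum_ge_1 mult_left_mono[of 1 L "4226 * real n ^ 3"] by (simp add: L_def)
  also have "4226 * real n ^ 3 * L + 49152 * real n ^ 3 * L \<le> 60000 * real n ^ 3 * L"
  proof -
    have "0 \<le> real n ^ 3 * L" using harmonic_sum_ge_1 by (simp add: L_def)
    then show ?thesis by linarith
  qed
  finally show ?thesis by (simp add: L_def)
qed

declare sum_of_bool_eq [simp del] sum_mult_of_bool_eq [simp del] sum_of_bool_mult_eq [simp del]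

text \<open>Zero is excluded because it has \<open>n\<close> representations, hence would be popular
  at all levels used, and because ratios need invertible differences.\<close>

definition rich :: "nat \<Rightarrow> int \<Rightarrow> bool" where "rich t d \<longleftrightarrow> \<not> int p dvd d \<and> t \<le> rep d"

definition rich_set :: "nat \<Rightarrow> int set" where "rich_set t = {d \<in> F. rich t d}"

lemma finite_rich_set [simp]: "finite (rich_set t)"
  unfolding rich_set_def by (rule finite_residues_Collect)

lemma rich_cong: "[d = e] (mod int p) \<Longrightarrow> rich t d \<longleftrightarrow> rich t e"
  unfolding rich_def using cong_dvd_iff rep_cong by metis

lemma rich_mod [simp]: "rich t (d mod int p) \<longleftrightarrow> rich t d"
  by (rule rich_cong) simp

lemma mod_in_rich_set: "d mod int p \<in> rich_set t \<longleftrightarrow> rich t d"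
  unfolding rich_set_def mem_Collect_eq rich_mod using mod_in_F by blast

lemma rich_scale: "unit_root u \<Longrightarrow> rich t (u * d) \<longleftrightarrow> rich t d"
  unfolding rich_def by (metis dvd_mult mult_not_dvd rep_scale root_not_dvd)

lemma card_rich_set_cube: "real (card (rich_set t)) * real t ^ 3 \<le> rep_moment 3"
proof -
  have "real (card (rich_set t)) * real t ^ 3 = (\<Sum>d\<in>rich_set t. real t ^ 3)" by simp
  also have "\<dots> \<le> (\<Sum>d\<in>rich_set t. real (rep d) ^ 3)"
    by (intro sum_mono power_mono) (auto simp: rich_set_def rich_def)
  also have "\<dots> \<le> rep_moment 3" unfolding rep_moment_def by (rule sum_mono2) (auto simp: rich_set_def)
  finally show ?thesis .
qed

section \<open>Triples with popular differences\<close>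

text \<open>The base point 1 stands for any element of \<open>G\<close>: multiplication by
  \<open>G\<close> permutes the graph of popular differences.\<close>

definition valency :: "nat \<Rightarrow> nat" where "valency t = card {x \<in> G. rich t (x - 1)}"

lemma card_rich_neighbours:
  assumes y: "y \<in> G" shows "card {x \<in> G. rich t (x - y)} = valency t"
proof -
  have ry: "unit_root y" using y G_iff by blast
  have "bij_betw (\<lambda>x. (y * x) mod int p) {x \<in> G. rich t (x - 1)} {x \<in> G. rich t (x - y)}"
  proof (rule bij_betw_Collect[OF bij_mult_G[OF ry]])
    fix x
    have "rich t ((y * x) mod int p - y) \<longleftrightarrow> rich t (y * (x - 1))"
      by (rule rich_cong) (simp add: cong_def mod_diff_left_eq right_diff_distrib)
    then show "rich t ((y * x) mod int p - y) \<longleftrightarrow> rich t (x - 1)" using rich_scale[OF ry] by simp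
  qed
  from bij_betw_same_card[OF this] show ?thesis by (simp add: valency_def)
qed

lemma sum_rich_neighbours: "y \<in> G \<Longrightarrow> (\<Sum>x\<in>G. of_bool (rich t (x - y))) = real (valency t)"
  unfolding card_rich_neighbours[symmetric] by (simp add: of_bool_def sum.If_cases Int_def)

lemma sum_rich_pairs: "(\<Sum>x\<in>G. \<Sum>y\<in>G. of_bool (rich t (x - y))) = real n * real (valency t)"
  by (subst sum.swap) (simp add: sum_rich_neighbours card_G)

text \<open>Double count of the edges of the popularity graph: each popular difference carries at
  least \<open>t\<close> ordered pairs, each vertex has \<open>valency t\<close> neighbours.\<close>

lemma card_rich_set_mult_le_valency: "real (card (rich_set t)) * real t \<le> real n * real (valency t)"
proof -
  have "real (card (rich_set t)) * real t = (\<Sum>d\<in>rich_set t. real t)" by simp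
  also have "\<dots> \<le> (\<Sum>d\<in>rich_set t. of_bool (rich t d) * real (rep d))"
    by (intro sum_mono) (auto simp: rich_set_def rich_def)
  also have "\<dots> \<le> (\<Sum>d\<in>F. of_bool (rich t d) * real (rep d))"
    by (rule sum_mono2) (auto simp: rich_set_def)
  also have "\<dots> = (\<Sum>y\<in>G. \<Sum>u\<in>G. of_bool (rich t (u - y)))" by (rule sum_rep_mult) simp
  also have "\<dots> = real n * real (valency t)" by (simp add: sum_rich_neighbours card_G)
  finally show ?thesis .
qed

definition triple_sum :: "nat \<Rightarrow> real" where
  "triple_sum t = (\<Sum>x\<in>G. \<Sum>y\<in>G. \<Sum>z\<in>G. of_bool (rich t (x - y)) * of_bool (rich t (x - z)) * real (rep (y - z)))"

text \<open>By invariance under \<open>G\<close> every vertex of the graph of popular differences has the same valency, so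
  Cauchy--Schwarz in \<open>x\<close> loses nothing against the constant vector.\<close>

lemma triple_sum_ge: "real (valency t) ^ 2 * rep_moment 2 \<le> real n * triple_sum t"
proof -
  define A where "A x y = (of_bool (rich t (x - y)) :: real)" for x y
  define B where "B y w = (of_bool (unit_root (y + w)) :: real)" for y w
  \<comment> \<open>For fixed \<open>x\<close>, the neighbours \<open>y\<close> with
    \<open>y + w\<close> in \<open>G\<close>. Squaring and summing over \<open>w\<close> produces
    the weight \<open>rep (y - z)\<close>; summing over \<open>x\<close> first factors as
    \<open>valency t * rep w\<close>.\<close>
  define c where "c x w = (\<Sum>y\<in>G. A x y * B y w)" for x w
  have T: "triple_sum t = (\<Sum>x\<in>G. \<Sum>w\<in>F. c x w ^ 2)"
    unfolding triple_sum_def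
  proof (rule sum.cong[OF refl])
    fix x
    have "(\<Sum>w\<in>F. c x w ^ 2) = (\<Sum>w\<in>F. \<Sum>y\<in>G. \<Sum>z\<in>G. A x y * A x z * (B z w * B y w))"
      unfolding c_def power2_eq_square sum_product by (intro sum.cong refl) (simp add: algebra_simps)
    also have "\<dots> = (\<Sum>y\<in>G. \<Sum>w\<in>F. \<Sum>z\<in>G. A x y * A x z * (B z w * B y w))" by (rule sum.swap)
    also have "\<dots> = (\<Sum>y\<in>G. \<Sum>z\<in>G. \<Sum>w\<in>F. A x y * A x z * (B z w * B y w))"
      by (intro sum.cong refl sum.swap)
    also have "\<dots> = (\<Sum>y\<in>G. \<Sum>z\<in>G. A x y * A x z * real (rep (y - z)))"
      by (simp only: rep_diff B_def sum_distrib_left)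
    finally show "(\<Sum>y\<in>G. \<Sum>z\<in>G. of_bool (rich t (x - y)) * of_bool (rich t (x - z)) * real (rep (y - z)))
       = (\<Sum>w\<in>F. c x w ^ 2)" by (simp add: A_def)
  qed
  have s: "(\<Sum>x\<in>G. c x w) = real (valency t) * real (rep w)" for w
  proof -
    have "(\<Sum>x\<in>G. c x w) = (\<Sum>y\<in>G. (\<Sum>x\<in>G. A x y) * B y w)"
      unfolding c_def sum_distrib_right by (rule sum.swap)
    also have "\<dots> = (\<Sum>y\<in>G. real (valency t) * B y w)"
      by (intro sum.cong refl) (simp add: A_def sum_rich_neighbours)
    finally show ?thesis by (simp add: rep_eq_sum B_def sum_distrib_left)
  qed
  have "real (valency t) ^ 2 * rep_moment 2 = (\<Sum>w\<in>F. (\<Sum>x\<in>G. c x w) ^ 2)"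
    unfolding s rep_moment_def by (simp add: power_mult_distrib sum_distrib_left)
  also have "\<dots> \<le> (\<Sum>w\<in>F. (\<Sum>x\<in>G. c x w ^ 2) * real (card G))"
    by (intro sum_mono sum_squared_le_sum_of_squares)
  also have "\<dots> = (\<Sum>w\<in>F. \<Sum>x\<in>G. c x w ^ 2) * real n" by (simp add: sum_distrib_right card_G)
  also have "\<dots> = real n * triple_sum t" unfolding T by (subst sum.swap) simp
  finally show ?thesis .
qed

text \<open>A triple is classified by the shift class of the ratio \<open>(x - z) / (y - z)\<close>.\<close>

definition heavy :: "int \<Rightarrow> int \<Rightarrow> bool" where
  "heavy a d \<longleftrightarrow> heavy_threshold p n \<le> shift_class_size p n (shift_class p n (a * minv d))"

lemma heavy_cong: "[a = b] (mod int p) \<Longrightarrow> [d = e] (mod int p) \<Longrightarrow> heavy a d \<longleftrightarrow> heavy b e"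
  unfolding heavy_def using minv_cong[of d e] shift_class_cong[OF cong_mult[OF _ cong_refl]] by metis

definition heavy_triple_sum :: "nat \<Rightarrow> real" where
  "heavy_triple_sum t = (\<Sum>x\<in>G. \<Sum>y\<in>G. \<Sum>z\<in>G.
     of_bool (y \<noteq> z \<and> rich t (x - y) \<and> rich t (x - z) \<and> heavy (x - z) (y - z)) * real (rep (y - z)))"

text \<open>In the variables \<open>a = x - y\<close> and \<open>b = x - z\<close> one has
  \<open>b - a = y - z\<close>, so a triple enters only through the number of admissible
  \<open>x\<close>.\<close>

definition light_weight :: "nat \<Rightarrow> int \<Rightarrow> int \<Rightarrow> real" where
  "light_weight t a b = of_bool (\<not> int p dvd b - a \<and> rich t a \<and> rich t b \<and> \<not> heavy b (b - a)) * real (rep (b - a))"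

lemma G_not_dvd_diff: "y \<in> G \<Longrightarrow> z \<in> G \<Longrightarrow> y \<noteq> z \<Longrightarrow> \<not> int p dvd y - z"
  using F_cong_eq G_iff cong_iff_dvd_diff by blast

text \<open>The first term is the diagonal \<open>y = z\<close>, where the weight is
  \<open>n\<close> and the remaining pairs are the edges of the graph.\<close>

lemma triple_sum_le:
  "triple_sum t \<le> real n ^ 2 * real (valency t) + heavy_triple_sum t +
     (\<Sum>x\<in>G. \<Sum>y\<in>G. \<Sum>z\<in>G. light_weight t (x - y) (x - z))"
proof -
  have "triple_sum t \<le> (\<Sum>x\<in>G. \<Sum>y\<in>G. \<Sum>z\<in>G. of_bool (y = z) * (of_bool (rich t (x - y)) * real n) +
     of_bool (y \<noteq> z \<and> rich t (x - y) \<and> rich t (x - z) \<and> heavy (x - z) (y - z)) * real (rep (y - z)) +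
     light_weight t (x - y) (x - z))"
    unfolding triple_sum_def
  proof (intro sum_mono)
    fix x y z assume "y \<in> G" "z \<in> G"
    then show "of_bool (rich t (x - y)) * of_bool (rich t (x - z)) * real (rep (y - z)) \<le>
      of_bool (y = z) * (of_bool (rich t (x - y)) * real n) +
      of_bool (y \<noteq> z \<and> rich t (x - y) \<and> rich t (x - z) \<and> heavy (x - z) (y - z)) * real (rep (y - z)) +
      light_weight t (x - y) (x - z)"
      using G_not_dvd_diff[of y z] by (auto simp: light_weight_def rep_dvd of_bool_def)
  qed
  also have "\<dots> = (\<Sum>x\<in>G. \<Sum>y\<in>G. \<Sum>z\<in>G. of_bool (y = z) * (of_bool (rich t (x - y)) * real n)) + heavy_triple_sum t +
     (\<Sum>x\<in>G. \<Sum>y\<in>G. \<Sum>z\<in>G. light_weight t (x - y) (x - z))"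
    by (simp only: sum.distrib heavy_triple_sum_def)
  also have "(\<Sum>x\<in>G. \<Sum>y\<in>G. \<Sum>z\<in>G. of_bool (y = z) * (of_bool (rich t (x - y)) * real n)) =
      (\<Sum>x\<in>G. \<Sum>y\<in>G. of_bool (rich t (x - y))) * real n"
    unfolding sum_distrib_right by (intro sum.cong refl) (simp add: sum_of_bool_mult_eq)
  finally show ?thesis unfolding sum_rich_pairs by (simp add: power2_eq_square algebra_simps)
qed

section \<open>Light triples\<close>

lemma bij_sub_F: "bij_betw (\<lambda>d. (y - d) mod int p) F F"
proof -
  have inj: "inj_on (\<lambda>d. (y - d) mod int p) F"
  proof (rule inj_onI)
    fix d e assume *: "d \<in> F" "e \<in> F" "(y - d) mod int p = (y - e) mod int p"
    then have "[y - d = y - e] (mod int p)" by (simp add: cong_def)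
    then have "[e = d] (mod int p)" by (simp add: cong_iff_dvd_diff)
    then show "d = e" using F_cong_eq * by blast
  qed
  moreover have "(\<lambda>d. (y - d) mod int p) ` F \<subseteq> F" by (auto simp del: atLeastLessThan_iff)
  ultimately show ?thesis unfolding bij_betw_def using endo_inj_surj[of F] by simp
qed

lemma sum_reflect:
  fixes h :: "int \<Rightarrow> real"
  assumes h: "\<And>d. h (d mod int p) = h d"
  shows "(\<Sum>d\<in>F. h (y - d)) = (\<Sum>d\<in>F. h d)"
  using sum.reindex_bij_betw[OF bij_sub_F[of y], of h] by (simp add: h)

lemma sum_root_reflect:
  fixes h :: "int \<Rightarrow> real"
  assumes h: "\<And>d. h (d mod int p) = h d"
  shows "(\<Sum>d\<in>F. of_bool (unit_root (y - d)) * h d) = (\<Sum>u\<in>G. h (y - u))"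
proof -
  have hh: "h (y - d mod int p) = h (y - d)" for d
    by (metis h mod_diff_right_eq)
  have "(\<Sum>d\<in>F. of_bool (unit_root (y - d)) * h d) = (\<Sum>d\<in>F. (\<lambda>u. of_bool (unit_root u) * h (y - u)) (y - d))"
    by simp
  also have "\<dots> = (\<Sum>u\<in>F. of_bool (unit_root u) * h (y - u))"
    by (rule sum_reflect) (simp add: hh)
  also have "\<dots> = (\<Sum>u\<in>G. h (y - u))"
    by (rule sum.mono_neutral_cong_right) (auto simp: G_iff)
  finally show ?thesis .
qed

lemma light_weight_mod:
  "light_weight t (a mod int p) b = light_weight t a b" "light_weight t a (b mod int p) = light_weight t a b"
proof -
  have *: "light_weight t a b = light_weight t a' b'" if "[a = a'] (mod int p)" "[b = b'] (mod int p)" for a b a' b'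
  proof -
    have d: "[b - a = b' - a'] (mod int p)" using that by (intro cong_diff)
    show ?thesis unfolding light_weight_def
      using cong_dvd_iff[OF d] rich_cong[OF that(1)] rich_cong[OF that(2)] heavy_cong[OF that(2) d] rep_cong[OF d] by simp
  qed
  show "light_weight t (a mod int p) b = light_weight t a b" "light_weight t a (b mod int p) = light_weight t a b"
    by (rule *; simp)+
qed

definition triple_rep :: "int \<Rightarrow> int \<Rightarrow> real" where
  "triple_rep a b = (\<Sum>x\<in>G. of_bool (unit_root (x - a)) * of_bool (unit_root (x - b)))"

text \<open>Squaring introduces a second element of \<open>G\<close>. For a fixed pair
  \<open>x, y\<close> the sums over \<open>a\<close> and \<open>b\<close> separate, each equal to
  \<open>rep (y - x)\<close>, and the pairs supply the third factor.\<close>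

lemma sum_triple_rep_squared: "(\<Sum>a\<in>F. \<Sum>b\<in>F. triple_rep a b ^ 2) = rep_moment 3"
proof -
  define B where "B x a = (of_bool (unit_root (x - a)) :: real)" for x a
  have um: "unit_root (x - a mod int p) \<longleftrightarrow> unit_root (x - a)" for x a
    by (rule root_cong) (simp add: cong_def mod_diff_right_eq)
  have BB: "(\<Sum>a\<in>F. B x a * B y a) = real (rep (y - x))" for x y
    unfolding B_def by (subst sum_root_reflect) (simp_all add: um rep_eq_sum algebra_simps)
  have "(\<Sum>a\<in>F. \<Sum>b\<in>F. triple_rep a b ^ 2) =
     (\<Sum>a\<in>F. \<Sum>b\<in>F. \<Sum>x\<in>G. \<Sum>y\<in>G. (B x a * B y a) * (B x b * B y b))"
    unfolding triple_rep_def power2_eq_square sum_product B_def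
    by (intro sum.cong refl) (simp add: algebra_simps)
  also have "\<dots> = (\<Sum>a\<in>F. \<Sum>x\<in>G. \<Sum>b\<in>F. \<Sum>y\<in>G. (B x a * B y a) * (B x b * B y b))"
    by (intro sum.cong refl sum.swap)
  also have "\<dots> = (\<Sum>a\<in>F. \<Sum>x\<in>G. \<Sum>y\<in>G. \<Sum>b\<in>F. (B x a * B y a) * (B x b * B y b))"
    by (intro sum.cong refl sum.swap)
  also have "\<dots> = (\<Sum>a\<in>F. \<Sum>x\<in>G. \<Sum>y\<in>G. (B x a * B y a) * real (rep (y - x)))"
    by (simp only: sum_distrib_left[symmetric] BB)
  also have "\<dots> = (\<Sum>x\<in>G. \<Sum>a\<in>F. \<Sum>y\<in>G. (B x a * B y a) * real (rep (y - x)))" by (rule sum.swap)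
  also have "\<dots> = (\<Sum>x\<in>G. \<Sum>y\<in>G. \<Sum>a\<in>F. (B x a * B y a) * real (rep (y - x)))"
    by (intro sum.cong refl sum.swap)
  also have "\<dots> = (\<Sum>x\<in>G. \<Sum>y\<in>G. real (rep (y - x)) ^ 2)"
    by (simp only: sum_distrib_right[symmetric] BB power2_eq_square)
  also have "\<dots> = (\<Sum>d\<in>F. real (rep d) ^ 2 * real (rep d))"
    by (rule sum_rep_mult[where h = "\<lambda>d. real (rep d) ^ 2", symmetric]) simp
  finally show ?thesis by (simp add: rep_moment_def power2_eq_square power3_eq_cube)
qed

lemma light_sum_eq:
  "(\<Sum>x\<in>G. \<Sum>y\<in>G. \<Sum>z\<in>G. light_weight t (x - y) (x - z)) =
   (\<Sum>a\<in>F. \<Sum>b\<in>F. triple_rep a b * light_weight t a b)"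
proof -
  define B where "B x a = (of_bool (unit_root (x - a)) :: real)" for x a
  have "(\<Sum>y\<in>G. \<Sum>z\<in>G. light_weight t (x - y) (x - z)) = (\<Sum>a\<in>F. \<Sum>b\<in>F. B x a * B x b * light_weight t a b)" for x
  proof -
    have "(\<Sum>y\<in>G. \<Sum>z\<in>G. light_weight t (x - y) (x - z)) = (\<Sum>y\<in>G. \<Sum>b\<in>F. B x b * light_weight t (x - y) b)"
      unfolding B_def by (subst sum_root_reflect) (simp_all add: light_weight_mod)
    also have "\<dots> = (\<Sum>a\<in>F. B x a * (\<Sum>b\<in>F. B x b * light_weight t a b))"
      unfolding B_def
      by (rule sum_root_reflect[where h = "\<lambda>a. \<Sum>b\<in>F. of_bool (unit_root (x - b)) * light_weight t a b", symmetric])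
         (simp add: light_weight_mod)
    finally show ?thesis by (simp add: sum_distrib_left mult.assoc)
  qed
  then have "(\<Sum>x\<in>G. \<Sum>y\<in>G. \<Sum>z\<in>G. light_weight t (x - y) (x - z)) =
    (\<Sum>x\<in>G. \<Sum>a\<in>F. \<Sum>b\<in>F. B x a * B x b * light_weight t a b)" by simp
  also have "\<dots> = (\<Sum>a\<in>F. \<Sum>x\<in>G. \<Sum>b\<in>F. B x a * B x b * light_weight t a b)" by (rule sum.swap)
  also have "\<dots> = (\<Sum>a\<in>F. \<Sum>b\<in>F. \<Sum>x\<in>G. B x a * B x b * light_weight t a b)"
    by (intro sum.cong refl sum.swap)
  finally show ?thesis by (simp add: triple_rep_def B_def sum_distrib_right)
qed

text \<open>Each fibre of an invariant map contains a full orbit under \<open>G\<close>, which has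
  \<open>n\<close> elements because \<open>s\<close> is a unit.\<close>

lemma card_invariant_image:
  assumes S: "finite S" "\<And>s. s \<in> S \<Longrightarrow> \<not> int p dvd s"
    and inv: "\<And>u s. u \<in> G \<Longrightarrow> s \<in> S \<Longrightarrow> (u * s) mod int p \<in> S \<and> f ((u * s) mod int p) = f s"
  shows "n * card (f ` S) \<le> card S"
proof (rule card_image_mult_le[OF S(1)])
  fix y assume "y \<in> f ` S"
  then obtain s where s: "s \<in> S" "y = f s" by blast
  have "inj_on (\<lambda>u. (s * u) mod int p) G"
    using bij_mult_F[OF S(2)[OF s(1)]] unfolding bij_betw_def
    by (rule inj_on_subset[OF conjunct1]) (auto simp: G_iff)
  then have "n = card ((\<lambda>u. (s * u) mod int p) ` G)" by (simp add: card_image card_G)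
  also have "\<dots> \<le> card {x \<in> S. f x = y}"
    using inv s S(1) by (intro card_mono) (auto simp: mult.commute)
  finally show "n \<le> card {x \<in> S. f x = y}" .
qed

lemma rich_set_invariant: "u \<in> G \<Longrightarrow> s \<in> rich_set t \<Longrightarrow> (u * s) mod int p \<in> rich_set t"
  unfolding mod_in_rich_set using rich_scale G_iff by (simp add: rich_set_def)

lemma rich_set_not_dvd: "s \<in> rich_set t \<Longrightarrow> \<not> int p dvd s"
  by (simp add: rich_set_def rich_def)

lemma root_mult_power_mod:
  assumes "unit_root u" "[x = u * s] (mod int p)" shows "x ^ n mod int p = s ^ n mod int p"
proof -
  have "[x ^ n = u ^ n * s ^ n] (mod int p)" unfolding power_mult_distrib[symmetric] using assms(2) by (rule cong_pow)
  moreover have "[u ^ n * s ^ n = 1 * s ^ n] (mod int p)"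
    using assms(1) cong_mult[OF _ cong_refl] unfolding unit_root_def by blast
  ultimately have "[x ^ n = 1 * s ^ n] (mod int p)" using cong_trans by blast
  then show ?thesis by (simp add: cong_def)
qed

lemma card_power_image: "n * card ((\<lambda>a. (a * i) ^ n mod int p) ` rich_set t) \<le> card (rich_set t)"
proof (rule card_invariant_image[OF finite_rich_set rich_set_not_dvd])
  fix u s assume "u \<in> G" "s \<in> rich_set t"
  moreover from this have "((u * s) mod int p * i) ^ n mod int p = (s * i) ^ n mod int p"
    by (intro root_mult_power_mod[of u]) (auto simp: G_iff cong_def mod_mult_left_eq mult.assoc)
  ultimately show "(u * s) mod int p \<in> rich_set t \<and> ((u * s) mod int p * i) ^ n mod int p = (s * i) ^ n mod int p"
    using rich_set_invariant by blast
qed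

text \<open>With \<open>d = y - z\<close> fixed, the class of \<open>b / d\<close> is given by the
  \<open>n\<close>-th powers of \<open>b / d\<close> and \<open>- (b - d) / d\<close>. Both
  numerators are popular, so by invariance each coordinate takes at most
  \<open>card (rich_set t) / n\<close> values, and a light class holds fewer elements than the
  threshold.\<close>

lemma card_light_fibre:
  assumes d: "\<not> int p dvd d"
  shows "n ^ 2 * card {b \<in> F. rich t b \<and> rich t (b - d) \<and> \<not> heavy b d} \<le> card (rich_set t) ^ 2 * heavy_threshold p n"
proof -
  define i where "i = minv d"
  define A where "A = (\<lambda>a. (a * i) ^ n mod int p) ` rich_set t"
  define B where "B = (\<lambda>a. (a * (- i)) ^ n mod int p) ` rich_set t"
  define K where "K = {k \<in> A \<times> B. shift_class_size p n k < heavy_threshold p n}"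
  have i: "\<not> int p dvd i" unfolding i_def using d by (rule minv_not_dvd)
  have finAB: "finite (A \<times> B)" by (simp add: A_def B_def)
  then have finK: "finite K" by (simp add: K_def)
  have "card {b \<in> F. rich t b \<and> rich t (b - d) \<and> \<not> heavy b d} \<le> card {x \<in> {2..<int p}. shift_class p n x \<in> K}"
  proof (rule card_inj_on_le[where f = "\<lambda>b. (i * b) mod int p"])
    show "inj_on (\<lambda>b. (i * b) mod int p) {b \<in> F. rich t b \<and> rich t (b - d) \<and> \<not> heavy b d}"
      using bij_mult_F[OF i] unfolding bij_betw_def by (rule inj_on_subset[OF conjunct1]) blast
    show "(\<lambda>b. (i * b) mod int p) ` {b \<in> F. rich t b \<and> rich t (b - d) \<and> \<not> heavy b d}
       \<subseteq> {x \<in> {2..<int p}. shift_class p n x \<in> K}"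
    proof (rule image_subsetI)
      fix b assume b: "b \<in> {b \<in> F. rich t b \<and> rich t (b - d) \<and> \<not> heavy b d}"
      have 1: "[1 - i * b = (b - d) * (- i)] (mod int p)"
        using cong_diff[OF cong_sym[OF minv[OF d]] cong_refl, of "i * b"] by (simp add: i_def algebra_simps)
      have "\<not> int p dvd (b - d) * (- i)" using b i by (intro mult_not_dvd) (auto simp: rich_def)
      then have "\<not> int p dvd 1 - i * b" using cong_dvd_iff[OF 1] by blast
      moreover have "\<not> int p dvd i * b" using b i by (intro mult_not_dvd) (auto simp: rich_def)
      ultimately have "(i * b) mod int p \<in> {2..<int p}" by (intro residue_ge_2)
      moreover have "(i * b) ^ n mod int p \<in> A"
        unfolding A_def using b by (intro image_eqI[of _ _ b]) (auto simp: rich_set_def mult.commute)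
      moreover have "(1 - i * b) ^ n mod int p \<in> B"
      proof -
        have "(b - d) mod int p \<in> rich_set t" using b by (simp add: mod_in_rich_set)
        moreover have "[(1 - i * b) ^ n = ((b - d) mod int p * (- i)) ^ n] (mod int p)"
        proof (rule cong_pow, rule cong_trans[OF 1])
          show "[(b - d) * (- i) = (b - d) mod int p * (- i)] (mod int p)" by (rule cong_mult) (simp_all add: cong_def)
        qed
        ultimately show ?thesis unfolding B_def by (intro image_eqI[of _ _ "(b - d) mod int p"]) (auto simp: cong_def)
      qed
      moreover have "shift_class_size p n (shift_class p n (i * b)) < heavy_threshold p n"
        using b by (auto simp: heavy_def i_def mult.commute)
      ultimately show "(i * b) mod int p \<in> {x \<in> {2..<int p}. shift_class p n x \<in> K}"
        unfolding K_def mem_Collect_eq shift_class_mod by (auto simp: shift_class_def)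
    qed
  qed (rule finite_residues_Collect)
  also have "\<dots> = (\<Sum>k\<in>K. shift_class_size p n k)" by (rule sum_shift_class_size[OF finK, symmetric])
  also have "\<dots> \<le> (\<Sum>k\<in>K. heavy_threshold p n)" by (intro sum_mono) (auto simp: K_def)
  also have "\<dots> \<le> card A * card B * heavy_threshold p n"
  proof -
    have "card K \<le> card (A \<times> B)" by (rule card_mono[OF finAB]) (auto simp: K_def)
    then show ?thesis by (simp add: card_cartesian_product)
  qed
  finally have "n ^ 2 * card {b \<in> F. rich t b \<and> rich t (b - d) \<and> \<not> heavy b d} \<le>
     n ^ 2 * (card A * card B * heavy_threshold p n)" by (rule mult_le_mono2)
  also have "\<dots> = (n * card A) * (n * card B) * heavy_threshold p n" by (simp add: power2_eq_square)
  also have "\<dots> \<le> card (rich_set t) * card (rich_set t) * heavy_threshold p n"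
    unfolding A_def B_def by (intro mult_le_mono card_power_image order_refl)
  finally show ?thesis by (simp add: power2_eq_square)
qed

text \<open>The substitution \<open>a = b - d\<close> groups the pairs by \<open>d\<close>, on which
  the weight is the constant \<open>rep d\<close>; the fibre count then leaves the second
  moment.\<close>

lemma sum_light_weight_squared:
  "real n ^ 2 * (\<Sum>a\<in>F. \<Sum>b\<in>F. light_weight t a b ^ 2) \<le>
     real (card (rich_set t)) ^ 2 * real (heavy_threshold p n) * rep_moment 2"
proof -
  have "(\<Sum>a\<in>F. \<Sum>b\<in>F. light_weight t a b ^ 2) = (\<Sum>b\<in>F. \<Sum>a\<in>F. light_weight t a b ^ 2)" by (rule sum.swap)
  also have "\<dots> = (\<Sum>b\<in>F. \<Sum>d\<in>F. light_weight t (b - d) b ^ 2)"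
    by (intro sum.cong refl sum_reflect[symmetric]) (simp add: light_weight_mod)
  also have "\<dots> = (\<Sum>d\<in>F. \<Sum>b\<in>F. light_weight t (b - d) b ^ 2)" by (rule sum.swap)
  finally have "real n ^ 2 * (\<Sum>a\<in>F. \<Sum>b\<in>F. light_weight t a b ^ 2) =
     (\<Sum>d\<in>F. real n ^ 2 * (\<Sum>b\<in>F. light_weight t (b - d) b ^ 2))" by (simp add: sum_distrib_left)
  also have "\<dots> \<le> (\<Sum>d\<in>F. real (card (rich_set t)) ^ 2 * real (heavy_threshold p n) * real (rep d) ^ 2)"
  proof (rule sum_mono)
    fix d
    show "real n ^ 2 * (\<Sum>b\<in>F. light_weight t (b - d) b ^ 2) \<le>
      real (card (rich_set t)) ^ 2 * real (heavy_threshold p n) * real (rep d) ^ 2"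
    proof (cases "int p dvd d")
      case True
      then have "light_weight t (b - d) b = 0" for b by (simp add: light_weight_def)
      then show ?thesis by simp
    next
      case False
      have "(\<Sum>b\<in>F. light_weight t (b - d) b ^ 2) =
         (\<Sum>b\<in>F. of_bool (rich t b \<and> rich t (b - d) \<and> \<not> heavy b d) * real (rep d) ^ 2)"
        using False by (intro sum.cong refl) (auto simp: light_weight_def)
      also have "\<dots> = real (card {b \<in> F. rich t b \<and> rich t (b - d) \<and> \<not> heavy b d}) * real (rep d) ^ 2"
        unfolding sum_distrib_right[symmetric] by (simp add: of_bool_def sum.If_cases Int_def)
      finally have "real n ^ 2 * (\<Sum>b\<in>F. light_weight t (b - d) b ^ 2) =
         real (n ^ 2 * card {b \<in> F. rich t b \<and> rich t (b - d) \<and> \<not> heavy b d}) * real (rep d) ^ 2" by simp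
      also have "\<dots> \<le> real (card (rich_set t) ^ 2 * heavy_threshold p n) * real (rep d) ^ 2"
        using card_light_fibre[OF False] by (intro mult_right_mono) (auto simp only: of_nat_le_iff zero_le_power2)
      finally show ?thesis by simp
    qed
  qed
  also have "\<dots> = real (card (rich_set t)) ^ 2 * real (heavy_threshold p n) * rep_moment 2"
    by (simp add: rep_moment_def sum_distrib_left)
  finally show ?thesis .
qed

lemma light_sum_le:
  "(real n * (\<Sum>x\<in>G. \<Sum>y\<in>G. \<Sum>z\<in>G. light_weight t (x - y) (x - z))) ^ 2 \<le>
     rep_moment 3 * (real (card (rich_set t)) ^ 2 * real (heavy_threshold p n) * rep_moment 2)"
proof -
  have "(\<Sum>a\<in>F. \<Sum>b\<in>F. triple_rep a b * light_weight t a b) ^ 2 \<le>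
     (\<Sum>a\<in>F. \<Sum>b\<in>F. triple_rep a b ^ 2) * (\<Sum>a\<in>F. \<Sum>b\<in>F. light_weight t a b ^ 2)"
    unfolding sum.cartesian_product
    using Cauchy_Schwarz_ineq_sum[of "\<lambda>(a, b). triple_rep a b" "\<lambda>(a, b). light_weight t a b" "F \<times> F"]
    by (simp add: case_prod_unfold)
  then have "(real n * (\<Sum>a\<in>F. \<Sum>b\<in>F. triple_rep a b * light_weight t a b)) ^ 2 \<le>
     real n ^ 2 * (rep_moment 3 * (\<Sum>a\<in>F. \<Sum>b\<in>F. light_weight t a b ^ 2))"
    unfolding power_mult_distrib sum_triple_rep_squared by (intro mult_left_mono) auto
  also have "\<dots> = rep_moment 3 * (real n ^ 2 * (\<Sum>a\<in>F. \<Sum>b\<in>F. light_weight t a b ^ 2))" by simp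
  also have "\<dots> \<le> rep_moment 3 * (real (card (rich_set t)) ^ 2 * real (heavy_threshold p n) * rep_moment 2)"
    by (intro mult_left_mono sum_light_weight_squared) (simp add: rep_moment_def sum_nonneg)
  finally show ?thesis unfolding light_sum_eq .
qed

section \<open>Heavy triples\<close>

definition heavy_triples :: "nat \<Rightarrow> nat \<Rightarrow> (int \<times> int \<times> int) set" where
  "heavy_triples t s = {(x, y, z) \<in> G \<times> G \<times> G. y \<noteq> z \<and> rich t (x - y) \<and> rich t (x - z) \<and>
      heavy (x - z) (y - z) \<and> s \<le> rep (y - z)}"

lemma heavy_triple_sum_eq: "heavy_triple_sum t = (\<Sum>s=1..n. real (card (heavy_triples t s)))"
proof -
  define h where "h = (\<lambda>(x, y, z). y \<noteq> z \<and> rich t (x - y) \<and> rich t (x - z) \<and> heavy (x - z) (y - z))"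
  define r where "r = (\<lambda>(x :: int, y, z). rep (y - z))"
  have r: "real (r v) = (\<Sum>s=1..n. of_bool (s \<le> r v))" for v
  proof -
    have "r v \<le> n" using rep_le by (auto simp: r_def split: prod.split)
    then have "{1..n} \<inter> {s. s \<le> r v} = {1..r v}" by auto
    then show ?thesis by (simp add: sum_of_bool_eq)
  qed
  have "heavy_triple_sum t = (\<Sum>v\<in>G \<times> G \<times> G. of_bool (h v) * real (r v))"
    unfolding heavy_triple_sum_def by (simp add: sum.cartesian_product case_prod_unfold h_def r_def)
  also have "\<dots> = (\<Sum>v\<in>G \<times> G \<times> G. \<Sum>s=1..n. of_bool (h v \<and> s \<le> r v))"
    unfolding r by (intro sum.cong refl) simp
  also have "\<dots> = (\<Sum>s=1..n. \<Sum>v\<in>G \<times> G \<times> G. of_bool (h v \<and> s \<le> r v))" by (rule sum.swap)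
  also have "\<dots> = (\<Sum>s=1..n. real (card (heavy_triples t s)))"
  proof (rule sum.cong[OF refl])
    fix s
    have "heavy_triples t s = (G \<times> G \<times> G) \<inter> {v. h v \<and> s \<le> r v}"
      by (auto simp: heavy_triples_def h_def r_def)
    then show "(\<Sum>v\<in>G \<times> G \<times> G. of_bool (h v \<and> s \<le> r v)) = real (card (heavy_triples t s))"
      by (simp add: sum_of_bool_eq)
  qed
  finally show ?thesis .
qed

text \<open>With \<rho> the ratio \<open>(x - z) / (y - z)\<close>, one has
  \<open>1 - \<rho> = - (x - y) / (y - z)\<close>, so its class is determined by the
  \<open>n\<close>-th powers of three popular differences. This set holds all combinations of such
  powers, whether or not a triple realises them; each of the three factors saves a factor
  \<open>n\<close> by invariance.\<close>

definition ratio_classes :: "nat \<Rightarrow> nat \<Rightarrow> (int \<times> int) set" where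
  "ratio_classes t s = (\<lambda>(a, b, c). (a * c mod int p, b * c mod int p)) `
     (((\<lambda>a. (a * 1) ^ n mod int p) ` rich_set t) \<times> ((\<lambda>a. (a * (- 1)) ^ n mod int p) ` rich_set t) \<times>
      ((\<lambda>d. minv d ^ n mod int p) ` rich_set s))"

lemma finite_ratio_classes: "finite (ratio_classes t s)"
  by (simp add: ratio_classes_def)

lemma minv_power_invariant:
  assumes "unit_root u" "\<not> int p dvd s" shows "minv (u * s) ^ n mod int p = minv s ^ n mod int p"
proof -
  have us: "\<not> int p dvd u * s" using assms root_not_dvd mult_not_dvd by blast
  have "[s * (minv u * minv s * (u * s)) = s * 1] (mod int p)"
  proof -
    have "[(u * minv u) * (s * minv s) * s = 1 * 1 * s] (mod int p)"
      by (intro cong_mult minv root_not_dvd assms cong_refl)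
    then show ?thesis by (simp add: algebra_simps)
  qed
  then have "[minv u * minv s * (u * s) = 1] (mod int p)" by (rule cancel_unit[OF assms(2)])
  then have "[(u * s) * (minv u * minv s) = (u * s) * minv (u * s)] (mod int p)"
    using cong_trans[OF _ cong_sym[OF minv[OF us]]] by (simp add: mult.commute)
  then have "[minv u * minv s = minv (u * s)] (mod int p)" by (rule cancel_unit[OF us])
  then show ?thesis using root_mult_power_mod[OF root_minv[OF assms(1)] cong_sym] by blast
qed

lemma card_minv_power_image: "n * card ((\<lambda>d. minv d ^ n mod int p) ` rich_set s) \<le> card (rich_set s)"
proof (rule card_invariant_image[OF finite_rich_set rich_set_not_dvd])
  fix u d assume ud: "u \<in> G" "d \<in> rich_set s"
  then have "minv ((u * d) mod int p) ^ n mod int p = minv d ^ n mod int p"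
    using minv_power_invariant rich_set_not_dvd G_iff by simp
  then show "(u * d) mod int p \<in> rich_set s \<and> minv ((u * d) mod int p) ^ n mod int p = minv d ^ n mod int p"
    using rich_set_invariant ud by blast
qed

lemma card_ratio_classes: "n ^ 3 * card (ratio_classes t s) \<le> card (rich_set t) ^ 2 * card (rich_set s)"
proof -
  define A where "A = (\<lambda>a. (a * 1) ^ n mod int p) ` rich_set t"
  define B where "B = (\<lambda>a. (a * (- 1)) ^ n mod int p) ` rich_set t"
  define C where "C = (\<lambda>d. minv d ^ n mod int p) ` rich_set s"
  have "card (ratio_classes t s) \<le> card (A \<times> B \<times> C)"
    unfolding ratio_classes_def A_def B_def C_def by (rule card_image_le) simp
  then have "n ^ 3 * card (ratio_classes t s) \<le> n ^ 3 * (card A * (card B * card C))"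
    by (simp add: card_cartesian_product)
  also have "\<dots> = (n * card A) * ((n * card B) * (n * card C))" by (simp add: power3_eq_cube)
  also have "\<dots> \<le> card (rich_set t) * (card (rich_set t) * card (rich_set s))"
    unfolding A_def B_def C_def by (intro mult_le_mono card_power_image card_minv_power_image)
  finally show ?thesis by (simp add: power2_eq_square mult.assoc)
qed

text \<open>If \<open>\<rho> = (x - z) / (y - z)\<close>, then \<open>x = \<rho> y + (1 - \<rho>) z\<close>, so \<open>\<rho> y / x\<close> has the same shift class as \<open>\<rho>\<close>.
  Hence the ratio \<open>\<rho>\<close> occurs for at most \<open>n\<close> times the size of its class many triples. Counting ratios
  rather than pairs of differences avoids losing the multiplicity of proportional pairs.\<close>

lemma card_heavy_triples:
  "card (heavy_triples t s) \<le> n * (\<Sum>k | k \<in> ratio_classes t s \<and> heavy_threshold p n \<le> shift_class_size p n k.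
     shift_class_size p n k ^ 2)"
proof -
  define K where "K = {k. k \<in> ratio_classes t s \<and> heavy_threshold p n \<le> shift_class_size p n k}"
  define D where "D k = {x \<in> {2..<int p}. shift_class p n x = k}" for k
  define \<rho> where "\<rho> = (\<lambda>(x, y, z). (x - z) * minv (y - z))"
  \<comment> \<open>Injective on triples: the third entry returns \<open>y\<close>, and then
    \<open>1 - \<rho> y / x = (z / x) (1 - \<rho>)\<close> returns \<open>z\<close>. The last two
    entries lie in the same class, hence the squared class size.\<close>
  define f where "f = (\<lambda>(x, y, z). (x, (\<rho> (x, y, z)) mod int p, (\<rho> (x, y, z) * y * minv x) mod int p))"
  have finK: "finite K" unfolding K_def using finite_ratio_classes by simp
  have finD: "finite (D k)" for k unfolding D_def by (rule finite_residues_Collect)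
  have main: "\<not> int p dvd \<rho> (x, y, z)" "\<not> int p dvd 1 - \<rho> (x, y, z)"
      "\<not> int p dvd \<rho> (x, y, z) * y * minv x"
      "[1 - \<rho> (x, y, z) * y * minv x = (z * minv x) * (1 - \<rho> (x, y, z))] (mod int p)"
      "[1 - \<rho> (x, y, z) = (x - y) * (- 1) * minv (y - z)] (mod int p)"
      "unit_root x" "unit_root y" "unit_root z" "\<not> int p dvd y - z"
    if T: "(x, y, z) \<in> heavy_triples t s" for x y z
  proof -
    have rt: "unit_root x" "unit_root y" "unit_root z" using T by (auto simp: heavy_triples_def G_iff)
    have d: "\<not> int p dvd y - z" using T by (intro G_not_dvd_diff) (auto simp: heavy_triples_def)
    define r where "r = \<rho> (x, y, z)"
    define i where "i = minv (y - z)"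
    have ri: "r = (x - z) * i" by (simp add: r_def \<rho>_def i_def)
    have i: "\<not> int p dvd i" unfolding i_def using d by (rule minv_not_dvd)
    have xy: "\<not> int p dvd x - y" "\<not> int p dvd x - z" using T by (auto simp: heavy_triples_def rich_def)
    have r: "\<not> int p dvd r" unfolding ri using xy i by (intro mult_not_dvd)
    have mi: "[(y - z) * i = 1] (mod int p)" unfolding i_def by (rule minv[OF d])
    have 1: "[1 - r = (x - y) * (- 1) * i] (mod int p)"
      using cong_diff[OF cong_sym[OF mi] cong_refl, of r] by (simp add: ri algebra_simps)
    have "\<not> int p dvd (x - y) * (- 1) * i" using xy i by (intro mult_not_dvd) auto
    then have 2: "\<not> int p dvd 1 - r" using cong_dvd_iff[OF 1] by blast
    have mx: "[x * minv x = 1] (mod int p)" using minv root_not_dvd rt by blast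
    have "[r * (y - z) = x - z] (mod int p)"
      using cong_mult[OF cong_refl mi, of "x - z"] by (simp add: ri algebra_simps)
    then have "[x - z - r * (y - z) = 0] (mod int p)"
      using cong_diff[OF cong_refl, of "r * (y - z)" "x - z" "int p" "x - z"] by simp
    then have "[minv x * (x - z - r * (y - z)) = minv x * 0] (mod int p)" by (rule cong_mult[OF cong_refl])
    then have "int p dvd minv x * (x - z - r * (y - z))" by (simp add: cong_iff_dvd_diff)
    moreover have "int p dvd 1 - x * minv x" using cong_sym[OF mx] by (simp add: cong_iff_dvd_diff)
    ultimately have "int p dvd minv x * (x - z - r * (y - z)) + (1 - x * minv x)" by (rule dvd_add)
    also have "minv x * (x - z - r * (y - z)) + (1 - x * minv x) = (1 - r * y * minv x) - (z * minv x) * (1 - r)"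
      by (simp add: algebra_simps)
    finally have 3: "[1 - r * y * minv x = (z * minv x) * (1 - r)] (mod int p)" by (simp add: cong_iff_dvd_diff)
    have 4: "\<not> int p dvd r * y * minv x"
      using r rt minv_not_dvd root_not_dvd by (intro mult_not_dvd) auto
    show "\<not> int p dvd \<rho> (x, y, z)" "\<not> int p dvd 1 - \<rho> (x, y, z)" "\<not> int p dvd \<rho> (x, y, z) * y * minv x"
      "[1 - \<rho> (x, y, z) * y * minv x = (z * minv x) * (1 - \<rho> (x, y, z))] (mod int p)"
      "[1 - \<rho> (x, y, z) = (x - y) * (- 1) * minv (y - z)] (mod int p)"
      "unit_root x" "unit_root y" "unit_root z" "\<not> int p dvd y - z"
      using r 2 4 3 1 rt d unfolding r_def i_def by blast+
  qed
  have "card (heavy_triples t s) \<le> card (G \<times> (\<Union>k\<in>K. D k \<times> D k))"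
  proof (rule card_inj_on_le[where f = f])
    show "inj_on f (heavy_triples t s)"
    proof (rule inj_onI)
      fix v v' assume v: "v \<in> heavy_triples t s" "v' \<in> heavy_triples t s" "f v = f v'"
      obtain x y z where xyz: "v = (x, y, z)" by (cases v)
      obtain x' y' z' where xyz': "v' = (x', y', z')" by (cases v')
      have xx: "x' = x" using v(3) by (simp add: xyz xyz' f_def)
      define r where "r = \<rho> (x, y, z)"
      define r' where "r' = \<rho> (x, y', z')"
      have T: "(x, y, z) \<in> heavy_triples t s" "(x, y', z') \<in> heavy_triples t s" using v xyz xyz' xx by auto
      note m = main[OF T(1), folded r_def] and m' = main[OF T(2), folded r'_def]
      have rr: "[r' = r] (mod int p)" and X: "[r * y * minv x = r' * y' * minv x] (mod int p)"
        using v(3) by (simp_all add: xyz xyz' xx f_def r_def r'_def cong_def)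
      have i: "\<not> int p dvd minv x" using m(6) minv_not_dvd root_not_dvd by blast
      have "[r' * y' * minv x = r * y' * minv x] (mod int p)" using rr by (intro cong_mult cong_refl)
      then have "[(r * minv x) * y = (r * minv x) * y'] (mod int p)"
        using cong_trans[OF X] by (simp add: algebra_simps)
      then have y: "[y = y'] (mod int p)" by (rule cancel_unit[OF mult_not_dvd[OF m(1) i]])
      have "[1 - r * y * minv x = 1 - r' * y' * minv x] (mod int p)" using X by (intro cong_diff cong_refl)
      then have "[(z * minv x) * (1 - r) = (z' * minv x) * (1 - r')] (mod int p)"
        using m(4) m'(4) cong_trans cong_sym by blast
      moreover have "[(z' * minv x) * (1 - r') = (z' * minv x) * (1 - r)] (mod int p)"
        using rr by (intro cong_mult cong_diff cong_refl)
      ultimately have "[(z * minv x) * (1 - r) = (z' * minv x) * (1 - r)] (mod int p)" using cong_trans by blast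
      then have "[(minv x * (1 - r)) * z = (minv x * (1 - r)) * z'] (mod int p)" by (simp add: mult_ac)
      then have z: "[z = z'] (mod int p)" by (rule cancel_unit[OF mult_not_dvd[OF i m(2)]])
      have "y \<in> F" "y' \<in> F" "z \<in> F" "z' \<in> F" using T unfolding heavy_triples_def using G_iff by blast+
      then show "v = v'" using F_cong_eq y z xx xyz xyz' by blast
    qed
    show "f ` heavy_triples t s \<subseteq> G \<times> (\<Union>k\<in>K. D k \<times> D k)"
    proof (rule image_subsetI)
      fix v assume v: "v \<in> heavy_triples t s"
      obtain x y z where xyz: "v = (x, y, z)" by (cases v)
      define r where "r = \<rho> (x, y, z)"
      define X where "X = r * y * minv x"
      have T: "(x, y, z) \<in> heavy_triples t s" using v xyz by simp
      note m = main[OF T, folded r_def, folded X_def]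
      define k where "k = shift_class p n r"
      have ri: "unit_root (minv x)" using m(6) by (rule root_minv)
      have "\<not> int p dvd (z * minv x) * (1 - r)" using m ri root_not_dvd by (intro mult_not_dvd) auto
      then have "\<not> int p dvd 1 - X" using cong_dvd_iff[OF m(4)] by blast
      then have X2: "X mod int p \<in> {2..<int p}" using m(3) by (intro residue_ge_2)
      have r2: "r mod int p \<in> {2..<int p}" using m(1,2) by (intro residue_ge_2)
      have kX: "shift_class p n X = k" unfolding k_def shift_class_def[of p n r]
        by (rule shift_class_root_mult[of _ "y * minv x" r "z * minv x"])
           (use m ri root_mult in \<open>auto simp: X_def mult_ac\<close>)
      have "k \<in> ratio_classes t s"
      proof -
        define a where "a = ((x - z) mod int p * 1) ^ n mod int p"
        define b where "b = ((x - y) mod int p * (- 1)) ^ n mod int p"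
        define c where "c = minv ((y - z) mod int p) ^ n mod int p"
        have ca: "[(x - z) mod int p * 1 = x - z] (mod int p)" and cb: "[(x - y) mod int p * (- 1) = (x - y) * (- 1)] (mod int p)"
          by (simp add: cong_def, rule cong_mult, simp_all add: cong_def)
        have "[a = (x - z) ^ n] (mod int p)" "[b = ((x - y) * (- 1)) ^ n] (mod int p)" "[c = minv (y - z) ^ n] (mod int p)"
          using cong_pow[OF ca, of n] cong_pow[OF cb, of n] by (simp_all add: a_def b_def c_def cong_def)
        then have "[a * c = (x - z) ^ n * minv (y - z) ^ n] (mod int p)"
          "[b * c = ((x - y) * (- 1)) ^ n * minv (y - z) ^ n] (mod int p)" by (auto intro!: cong_mult)
        moreover have "(x - z) ^ n * minv (y - z) ^ n = r ^ n" by (simp add: r_def \<rho>_def power_mult_distrib)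
        moreover have "[(1 - r) ^ n = ((x - y) * (- 1)) ^ n * minv (y - z) ^ n] (mod int p)"
          unfolding power_mult_distrib[symmetric] using m(5) by (rule cong_pow)
        ultimately have "(a * c mod int p, b * c mod int p) = k"
          unfolding k_def shift_class_def by (simp add: cong_def)
        moreover have "(x - z) mod int p \<in> rich_set t" "(x - y) mod int p \<in> rich_set t" "(y - z) mod int p \<in> rich_set s"
          using T m(9) by (auto simp: mod_in_rich_set heavy_triples_def rich_def)
        then have "(a, b, c) \<in> ((\<lambda>a. (a * 1) ^ n mod int p) ` rich_set t) \<times> ((\<lambda>a. (a * (- 1)) ^ n mod int p) ` rich_set t) \<times>
          ((\<lambda>d. minv d ^ n mod int p) ` rich_set s)" unfolding a_def b_def c_def by blast
        ultimately show ?thesis unfolding ratio_classes_def by force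
      qed
      moreover have "heavy_threshold p n \<le> shift_class_size p n k"
        using T by (simp add: heavy_triples_def heavy_def k_def r_def \<rho>_def)
      ultimately have "k \<in> K" by (simp add: K_def)
      moreover have "r mod int p \<in> D k" "X mod int p \<in> D k"
        unfolding D_def mem_Collect_eq shift_class_mod using r2 X2 kX by (auto simp: k_def)
      moreover have "x \<in> G" using T by (simp add: heavy_triples_def)
      moreover have "f v = (x, r mod int p, X mod int p)" by (simp add: f_def xyz r_def X_def)
      ultimately show "f v \<in> G \<times> (\<Union>k\<in>K. D k \<times> D k)" by auto
    qed
    show "finite (G \<times> (\<Union>k\<in>K. D k \<times> D k))" using finK finD by simp
  qed
  also have "\<dots> = n * card (\<Union>k\<in>K. D k \<times> D k)" by (simp add: card_cartesian_product card_G)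
  also have "\<dots> \<le> n * (\<Sum>k\<in>K. card (D k \<times> D k))" by (intro mult_le_mono2 card_UN_le finK)
  also have "(\<Sum>k\<in>K. card (D k \<times> D k)) = (\<Sum>k\<in>K. shift_class_size p n k ^ 2)"
    by (simp add: card_cartesian_product power2_eq_square shift_class_size_def D_def)
  finally show ?thesis by (simp add: K_def)
qed

text \<open>A cutoff \<open>V\<close> on the class size: smaller classes are paid for by their
  number, larger ones by the cube sum, through \<open>N^2 <= V^2 + N^3 / V\<close>.\<close>

lemma card_heavy_triples_le:
  assumes V: "V > 0"
  shows "real (card (heavy_triples t s)) \<le> real n * (V ^ 2 * real (card (ratio_classes t s)) +
     49152 * real n ^ 2 * harmonic_sum n / V)"
proof -
  define K where "K = {k. k \<in> ratio_classes t s \<and> heavy_threshold p n \<le> shift_class_size p n k}"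
  define H where "H = {k. heavy_threshold p n \<le> shift_class_size p n k}"
  define N where "N k = real (shift_class_size p n k)" for k
  have finH: "finite H" unfolding H_def by (rule finite_rich_shift_classes) (simp add: heavy_threshold_def)
  have "real (card (heavy_triples t s)) \<le> real n * (\<Sum>k\<in>K. N k ^ 2)"
  proof -
    have "real (card (heavy_triples t s)) \<le> real (n * (\<Sum>k\<in>K. shift_class_size p n k ^ 2))"
      using card_heavy_triples[of t s] unfolding K_def of_nat_le_iff .
    then show ?thesis by (simp add: N_def)
  qed
  also have "(\<Sum>k\<in>K. N k ^ 2) \<le> (\<Sum>k\<in>K. V ^ 2 + N k ^ 3 / V)"
  proof (rule sum_mono)
    fix k
    have N0: "N k \<ge> 0" by (simp add: N_def)
    show "N k ^ 2 \<le> V ^ 2 + N k ^ 3 / V"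
    proof (cases "N k \<le> V")
      case True
      then have "N k ^ 2 \<le> V ^ 2" using N0 by (intro power_mono)
      moreover have "0 \<le> N k ^ 3 / V" using N0 V by simp
      ultimately show ?thesis by linarith
    next
      case False
      then have "N k ^ 2 * V \<le> N k ^ 2 * N k" using N0 by (intro mult_left_mono) auto
      then have "N k ^ 2 \<le> N k ^ 3 / V" using V by (simp add: field_simps power2_eq_square power3_eq_cube)
      then show ?thesis using zero_le_power2[of V] by linarith
    qed
  qed
  also have "\<dots> = V ^ 2 * real (card K) + (\<Sum>k\<in>K. N k ^ 3) / V"
    by (simp add: sum.distrib sum_divide_distrib)
  also have "(\<Sum>k\<in>K. N k ^ 3) \<le> (\<Sum>k\<in>H. N k ^ 3)"
    by (rule sum_mono2[OF finH]) (auto simp: K_def H_def N_def)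
  also have "\<dots> \<le> 49152 * real n ^ 2 * harmonic_sum n"
    unfolding H_def N_def by (rule sum_cube_heavy_shift_classes[OF prime_p lower upper])
  also have "real (card K) \<le> real (card (ratio_classes t s))"
    unfolding of_nat_le_iff by (rule card_mono[OF finite_ratio_classes]) (auto simp: K_def)
  finally show ?thesis using V by (simp add: divide_right_mono mult_left_mono)
qed

lemma heavy_triple_sum_le:
  assumes U: "U > 0"
  shows "heavy_triple_sum t \<le> 60000 * real n * harmonic_sum n ^ 2 * (U ^ 2 * real (card (rich_set t)) ^ 2 + real n ^ 2 / U)"
proof -
  define L where "L = harmonic_sum n"
  define m where "m = real (card (rich_set t))"
  have L: "L \<ge> 1" unfolding L_def by (rule harmonic_sum_ge_1)
  have n0: "real n > 0" using n_pos by simp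
  have "heavy_triple_sum t \<le> (\<Sum>s=1..n. real n * (60000 * L * (U ^ 2 * m ^ 2 + real n ^ 2 / U)) * (1 / real s))"
    unfolding heavy_triple_sum_eq
  proof (rule sum_mono)
    fix s assume s: "s \<in> {1..n}"
    then have s0: "real s > 0" by simp
    have "real (card (rich_set s)) * real s ^ 3 \<le> 60000 * real n ^ 3 * L"
      using card_rich_set_cube[of s] rep_moment_3_le by (simp add: L_def)
    moreover have "real (n ^ 3 * card (ratio_classes t s)) \<le> real (card (rich_set t) ^ 2 * card (rich_set s))"
      using card_ratio_classes[of t s] by (simp only: of_nat_le_iff)
    then have "real n ^ 3 * real (card (ratio_classes t s)) \<le> m ^ 2 * real (card (rich_set s))" by (simp add: m_def)
    then have "real n ^ 3 * real (card (ratio_classes t s)) * real s ^ 3 \<le> m ^ 2 * real (card (rich_set s)) * real s ^ 3"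
      by (rule mult_right_mono) simp
    ultimately have "real n ^ 3 * real (card (ratio_classes t s)) * real s ^ 3 \<le> m ^ 2 * (60000 * real n ^ 3 * L)"
      by (smt (verit) mult.assoc mult_left_mono zero_le_power2)
    then have "real n ^ 3 * (real (card (ratio_classes t s)) * real s ^ 3) \<le> real n ^ 3 * (60000 * L * m ^ 2)"
      by (simp add: algebra_simps)
    then have R: "real (card (ratio_classes t s)) * real s ^ 3 \<le> 60000 * L * m ^ 2"
      using n0 by (simp only: mult_le_cancel_left_pos zero_less_power)
    \<comment> \<open>The number of ratio classes decays like \<open>s^(-3)\<close>; a cutoff
      proportional to \<open>s\<close> therefore makes both terms proportional to
      \<open>1 / s\<close>, and the sum over \<open>s\<close> costs a single harmonic sum.\<close>
    define V where "V = real s * U"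
    have V: "V > 0" using s0 U by (simp add: V_def)
    have "V ^ 2 * real (card (ratio_classes t s)) = U ^ 2 * (real (card (ratio_classes t s)) * real s ^ 3) / real s"
      using s0 by (simp add: V_def power_mult_distrib power2_eq_square power3_eq_cube)
    also have "\<dots> \<le> U ^ 2 * (60000 * L * m ^ 2) / real s"
      using R s0 by (intro divide_right_mono mult_left_mono) auto
    finally have "V ^ 2 * real (card (ratio_classes t s)) + 49152 * real n ^ 2 * L / V \<le>
       U ^ 2 * (60000 * L * m ^ 2) / real s + 60000 * real n ^ 2 * L / V"
      using V L by (intro add_mono divide_right_mono mult_right_mono) auto
    also have "\<dots> = 60000 * L * (U ^ 2 * m ^ 2 + real n ^ 2 / U) * (1 / real s)"
      using s0 U by (simp add: V_def field_simps)
    finally have "real n * (V ^ 2 * real (card (ratio_classes t s)) + 49152 * real n ^ 2 * L / V) \<le>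
       real n * (60000 * L * (U ^ 2 * m ^ 2 + real n ^ 2 / U) * (1 / real s))" by (rule mult_left_mono) simp
    then show "real (card (heavy_triples t s)) \<le> real n * (60000 * L * (U ^ 2 * m ^ 2 + real n ^ 2 / U)) * (1 / real s)"
      using card_heavy_triples_le[OF V, of t s] by (simp add: L_def)
  qed
  also have "\<dots> = real n * (60000 * L * (U ^ 2 * m ^ 2 + real n ^ 2 / U)) * L"
    by (simp only: sum_distrib_left[symmetric] L_def harmonic_sum_def)
  also have "\<dots> = 60000 * real n * L ^ 2 * (U ^ 2 * m ^ 2 + real n ^ 2 / U)" by (simp add: power2_eq_square)
  finally show ?thesis by (simp add: L_def m_def)
qed

section \<open>Choice of the level and the energy bound\<close>

text \<open>Pigeonhole with weights \<open>1 / t\<close>: if every level failed, the layer-cake sum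
  of \<open>2 * t * card (rich_set t)\<close> would be smaller than the energy off zero, which it
  dominates. The subtracted \<open>n^2\<close> is the contribution of the zero difference.\<close>

lemma exists_rich_level:
  "\<exists>t\<in>{1..n}. rep_moment 2 - real n ^ 2 \<le> 2 * harmonic_sum n * (real (card (rich_set t)) * real t ^ 2)"
proof (rule ccontr)
  assume "\<not> ?thesis"
  then have neg: "2 * harmonic_sum n * (real (card (rich_set t)) * real t ^ 2) < rep_moment 2 - real n ^ 2" if "t \<in> {1..n}" for t
    using that by (auto simp: not_le)
  define E where "E = rep_moment 2 - real n ^ 2"
  have L: "harmonic_sum n \<ge> 1" by (rule harmonic_sum_ge_1)
  have sq: "real r ^ 2 \<le> (\<Sum>t=1..r. 2 * real t)" for r :: nat
    by (induction r) (simp_all add: power2_eq_square algebra_simps)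
  have "F = insert 0 {1..<int p}" using p_gt_1 by auto
  then have "E = (\<Sum>d\<in>{1..<int p}. real (rep d) ^ 2)"
    by (simp add: E_def rep_moment_def rep_dvd)
  also have "\<dots> \<le> (\<Sum>d\<in>{1..<int p}. \<Sum>t=1..n. 2 * real t * of_bool (t \<le> rep d))"
  proof (rule sum_mono)
    fix d
    have "(\<Sum>t=1..rep d. 2 * real t) = (\<Sum>t=1..n. 2 * real t * of_bool (t \<le> rep d))"
      using rep_le[of d] by (intro sum.mono_neutral_cong_left) auto
    then show "real (rep d) ^ 2 \<le> (\<Sum>t=1..n. 2 * real t * of_bool (t \<le> rep d))" using sq[of "rep d"] by simp
  qed
  also have "\<dots> = (\<Sum>t=1..n. 2 * real t * (\<Sum>d\<in>{1..<int p}. of_bool (t \<le> rep d)))"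
    unfolding sum_distrib_left by (rule sum.swap)
  also have "\<dots> = (\<Sum>t=1..n. 2 * real t * real (card (rich_set t)))"
  proof (intro sum.cong refl)
    fix t
    have "rich_set t = {1..<int p} \<inter> {d. t \<le> rep d}"
      unfolding rich_set_def rich_def using zdvd_not_zless by (auto simp: int_one_le_iff_zero_less dvd_eq_mod_eq_0 order_le_less)
    then show "2 * real t * (\<Sum>d\<in>{1..<int p}. of_bool (t \<le> rep d)) = 2 * real t * real (card (rich_set t))"
      by (simp add: sum_of_bool_eq)
  qed
  also have "\<dots> < (\<Sum>t=1..n. E / harmonic_sum n * (1 / real t))"
  proof (rule sum_strict_mono)
    fix t assume t: "t \<in> {1..n}"
    then show "2 * real t * real (card (rich_set t)) < E / harmonic_sum n * (1 / real t)"
      using neg[OF t] L by (simp add: field_simps E_def power2_eq_square)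
  qed (use n_pos in auto)
  also have "\<dots> = E / harmonic_sum n * harmonic_sum n"
    by (simp only: sum_distrib_left[symmetric] harmonic_sum_def)
  also have "\<dots> = E" using L by simp
  finally show False by simp
qed

text \<open>Common to all cases are \<open>E <= 4 L m s^2\<close> (choice of \<open>t\<close>),
  \<open>m s^3 <= c n^3 L\<close> (third moment) and \<open>m s <= n v\<close> (edges). The dominant
  part of the triple sum supplies one further bound, and suitable powers are multiplied so that
  \<open>m\<close> and \<open>s\<close> appear only through \<open>m s^2\<close> and cancel. The
  alternatives are the heavy, light and diagonal part, in this order.\<close>

lemma rep_moment_2_trichotomy:
  fixes E L c :: real
  defines "E \<equiv> rep_moment 2" and "L \<equiv> harmonic_sum n" and "c \<equiv> 60000"
  assumes large: "2 * real n ^ 2 < E"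
  shows "E ^ 9 \<le> 884736 * c ^ 5 * L ^ 14 * real n ^ 22 \<or>
         E ^ 3 * real p \<le> 9360 * c * L ^ 3 * real n ^ 9 \<or> E ^ 3 \<le> 48 * c * L ^ 3 * real n ^ 7"
proof -
  have n0: "real n > 0" using n_pos by simp
  have L: "L \<ge> 1" unfolding L_def by (rule harmonic_sum_ge_1)
  have E0: "E > 0" using large zero_le_power2[of "real n"] by linarith
  obtain t where t: "t \<in> {1..n}" "E - real n ^ 2 \<le> 2 * L * (real (card (rich_set t)) * real t ^ 2)"
    using exists_rich_level unfolding E_def L_def by auto
  define m where "m = real (card (rich_set t))"
  define s where "s = real t"
  define v where "v = real (valency t)"
  define H where "H = heavy_triple_sum t"
  define Q where "Q = (\<Sum>x\<in>G. \<Sum>y\<in>G. \<Sum>z\<in>G. light_weight t (x - y) (x - z))"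
  have s0: "s > 0" using t by (simp add: s_def)
  have ms2: "E \<le> 4 * L * (m * s ^ 2)" using t(2) large unfolding m_def s_def by linarith
  have m0: "m > 0"
  proof (rule ccontr)
    assume "\<not> m > 0"
    then have "m = 0" by (simp add: m_def)
    then show False using ms2 E0 by simp
  qed
  have ms3: "m * s ^ 3 \<le> c * real n ^ 3 * L"
    using card_rich_set_cube[of t] rep_moment_3_le by (simp add: m_def s_def c_def L_def)
  have ms: "m * s \<le> real n * v" using card_rich_set_mult_le_valency[of t] by (simp add: m_def s_def v_def)
  have v0: "v > 0"
  proof (rule ccontr)
    assume "\<not> v > 0"
    then have "v = 0" by (simp add: v_def)
    then show False using ms m0 s0 by (simp add: mult_le_0_iff)
  qed
  have "v ^ 2 * E \<le> real n * triple_sum t" using triple_sum_ge by (simp add: v_def E_def)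
  also have "\<dots> \<le> real n * (real n ^ 2 * v + H + Q)"
    using triple_sum_le by (intro mult_left_mono) (auto simp: v_def H_def Q_def)
  finally have vE: "v ^ 2 * E \<le> real n ^ 3 * v + real n * H + real n * Q"
    by (simp add: algebra_simps power2_eq_square power3_eq_cube)
  have m2: "m ^ 2 * s ^ 2 * E \<le> real n ^ 2 * (v ^ 2 * E)"
  proof -
    have "(m * s) ^ 2 \<le> (real n * v) ^ 2" using ms m0 s0 by (intro power_mono) auto
    then have "m ^ 2 * s ^ 2 * E \<le> real n ^ 2 * v ^ 2 * E"
      using E0 by (intro mult_right_mono) (auto simp: power_mult_distrib)
    then show ?thesis by (simp add: mult.assoc)
  qed
  have E6: "E ^ k \<le> 4 ^ k * L ^ k * (m * s ^ 2) ^ k" for k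
  proof -
    have "E ^ k \<le> (4 * L * (m * s ^ 2)) ^ k" using ms2 E0 by (intro power_mono) auto
    then show ?thesis by (simp add: power_mult_distrib)
  qed
  consider "v ^ 2 * E \<le> 3 * (real n ^ 3 * v)" | "v ^ 2 * E \<le> 3 * (real n * H)" | "v ^ 2 * E \<le> 3 * (real n * Q)"
    using vE by linarith
  then show ?thesis
  proof cases
    case 1
    then have "v * (v * E) \<le> v * (3 * real n ^ 3)" by (simp add: power2_eq_square algebra_simps)
    then have "v * E \<le> 3 * real n ^ 3" using v0 by (simp only: mult_le_cancel_left_pos)
    then have "real n * (v * E) \<le> real n * (3 * real n ^ 3)" using n0 by (intro mult_left_mono) auto
    moreover have "m * s * E \<le> real n * v * E" using ms E0 by (intro mult_right_mono) auto
    ultimately have a: "m * s * E \<le> 3 * real n ^ 4" by (simp add: power3_eq_cube power4_eq_xxxx mult.assoc)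
    have "E ^ 3 = E ^ 2 * E" by (simp add: power2_eq_square power3_eq_cube)
    also have "\<dots> \<le> (4 ^ 2 * L ^ 2 * (m * s ^ 2) ^ 2) * E" using E6[of 2] E0 by (intro mult_right_mono) auto
    also have "\<dots> = 16 * L ^ 2 * ((m * s ^ 3) * (m * s * E))" by (simp add: power2_eq_square power3_eq_cube)
    also have "\<dots> \<le> 16 * L ^ 2 * ((c * real n ^ 3 * L) * (3 * real n ^ 4))"
      using mult_mono[OF ms3 a] L m0 s0 E0 by (intro mult_left_mono) (auto simp: c_def)
    also have "\<dots> = 48 * c * L ^ 3 * real n ^ 7" by (simp add: eval_nat_numeral)
    finally show ?thesis by blast
  next
    case 2
    \<comment> \<open>Balances the two terms of \<open>heavy_triple_sum_le\<close>:
      \<open>U^2 * m^2 = n^2 / U\<close>.\<close>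
    define U where "U = root 3 ((real n / m) ^ 2)"
    have U0: "U > 0" using n0 m0 by (simp add: U_def)
    have U3: "U ^ 3 = (real n / m) ^ 2" unfolding U_def by (rule real_root_pow_pos2) auto
    have "real n ^ 2 / U = U ^ 2 * m ^ 2"
    proof -
      have "U ^ 3 * m ^ 2 = real n ^ 2" unfolding U3 using m0 by (simp add: power_divide)
      then show ?thesis using U0 by (simp add: field_simps power2_eq_square power3_eq_cube)
    qed
    then have "H \<le> c * real n * L ^ 2 * (2 * (U ^ 2 * m ^ 2))"
      using heavy_triple_sum_le[OF U0, of t] by (simp add: H_def c_def L_def m_def)
    then have "real n ^ 2 * (3 * (real n * H)) \<le> real n ^ 2 * (3 * (real n * (c * real n * L ^ 2 * (2 * (U ^ 2 * m ^ 2)))))"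
      using n0 by (intro mult_left_mono) auto
    moreover have "real n ^ 2 * (v ^ 2 * E) \<le> real n ^ 2 * (3 * (real n * H))" using 2 by (intro mult_left_mono) auto
    ultimately have "m ^ 2 * s ^ 2 * E \<le> real n ^ 2 * (3 * (real n * (c * real n * L ^ 2 * (2 * (U ^ 2 * m ^ 2)))))"
      using m2 by linarith
    then have "m ^ 2 * (s ^ 2 * E) \<le> m ^ 2 * (6 * c * real n ^ 4 * L ^ 2 * U ^ 2)"
      by (simp add: algebra_simps power2_eq_square power4_eq_xxxx)
    then have "s ^ 2 * E \<le> 6 * c * real n ^ 4 * L ^ 2 * U ^ 2"
      using m0 by (simp only: mult_le_cancel_left_pos zero_less_power)
    then have "(s ^ 2 * E) ^ 3 \<le> (6 * c * real n ^ 4 * L ^ 2 * U ^ 2) ^ 3" using s0 E0 by (intro power_mono) auto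
    also have "\<dots> = 216 * c ^ 3 * real n ^ 12 * L ^ 6 * (U ^ 3) ^ 2" by (simp add: power_mult_distrib flip: power_mult)
    also have "\<dots> = 216 * c ^ 3 * real n ^ 16 * L ^ 6 / m ^ 4"
      unfolding U3 by (simp add: power_divide flip: power_mult power_add)
    finally have "s ^ 6 * E ^ 3 \<le> 216 * c ^ 3 * real n ^ 16 * L ^ 6 / m ^ 4"
      by (simp add: power_mult_distrib flip: power_mult)
    then have a: "m ^ 4 * s ^ 6 * E ^ 3 \<le> 216 * c ^ 3 * real n ^ 16 * L ^ 6"
      using m0 by (simp add: field_simps)
    have "(m * s ^ 3) ^ 2 \<le> (c * real n ^ 3 * L) ^ 2" using ms3 m0 s0 by (intro power_mono) auto
    then have b: "(m * s ^ 3) ^ 2 \<le> c ^ 2 * real n ^ 6 * L ^ 2" by (simp add: power_mult_distrib flip: power_mult)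
    have "E ^ 9 = E ^ 6 * E ^ 3" by (simp flip: power_add)
    also have "\<dots> \<le> (4 ^ 6 * L ^ 6 * (m * s ^ 2) ^ 6) * E ^ 3" using E6[of 6] E0 by (intro mult_right_mono) auto
    \<comment> \<open>The factors \<open>m^4 s^6\<close> and \<open>(m s^3)^2\<close> combine to
      \<open>(m s^2)^6\<close>; this dictates the exponent 9 = 6 + 3.\<close>
    also have "\<dots> = 4096 * L ^ 6 * ((m ^ 4 * s ^ 6 * E ^ 3) * (m * s ^ 3) ^ 2)"
      by (simp add: power_mult_distrib flip: power_mult) (simp add: eval_nat_numeral)
    also have "\<dots> \<le> 4096 * L ^ 6 * ((216 * c ^ 3 * real n ^ 16 * L ^ 6) * (c ^ 2 * real n ^ 6 * L ^ 2))"
      using mult_mono[OF a b] L by (intro mult_left_mono) (auto simp: c_def)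
    also have "\<dots> = 884736 * c ^ 5 * L ^ 14 * real n ^ 22" by (simp add: eval_nat_numeral)
    finally show ?thesis by blast
  next
    case 3
    define w where "w = real (heavy_threshold p n)"
    have w: "w * real p \<le> 65 * real n ^ 2"
    proof -
      have "real (heavy_threshold p n * p) \<le> real (65 * n ^ 2)" using heavy_threshold_mult_le by (simp only: of_nat_le_iff)
      then show ?thesis by (simp add: w_def)
    qed
    have "m ^ 2 * s ^ 2 * E \<le> 3 * real n ^ 2 * (real n * Q)"
    proof -
      have "real n ^ 2 * (v ^ 2 * E) \<le> real n ^ 2 * (3 * (real n * Q))" using 3 by (intro mult_left_mono) auto
      then show ?thesis using m2 by (simp add: algebra_simps)
    qed
    then have "(m ^ 2 * s ^ 2 * E) ^ 2 \<le> (3 * real n ^ 2 * (real n * Q)) ^ 2" using E0 by (intro power_mono) auto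
    also have "\<dots> = 9 * real n ^ 4 * (real n * Q) ^ 2" by (simp add: power_mult_distrib flip: power_mult)
    also have "\<dots> \<le> 9 * real n ^ 4 * (rep_moment 3 * (m ^ 2 * w * E))"
      using light_sum_le[of t] by (intro mult_left_mono) (auto simp: Q_def m_def w_def E_def)
    also have "\<dots> \<le> 9 * real n ^ 4 * ((c * real n ^ 3 * L) * (m ^ 2 * w * E))"
      using rep_moment_3_le E0 by (intro mult_left_mono mult_right_mono) (auto simp: c_def L_def w_def)
    finally have "(m ^ 2 * E) * ((m * s ^ 2) ^ 2 * E) \<le> (m ^ 2 * E) * (9 * c * real n ^ 7 * L * w)"
      by (simp add: power_mult_distrib flip: power_mult) (simp add: eval_nat_numeral algebra_simps)
    then have a: "(m * s ^ 2) ^ 2 * E \<le> 9 * c * real n ^ 7 * L * w"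
      using m0 E0 by (simp only: mult_le_cancel_left_pos zero_less_power mult_pos_pos)
    have "E ^ 3 * real p = E ^ 2 * E * real p" by (simp add: power2_eq_square power3_eq_cube)
    also have "\<dots> \<le> (4 ^ 2 * L ^ 2 * (m * s ^ 2) ^ 2) * E * real p" using E6[of 2] E0 by (intro mult_right_mono) auto
    also have "\<dots> = 16 * L ^ 2 * ((m * s ^ 2) ^ 2 * E) * real p" by simp
    also have "\<dots> \<le> 16 * L ^ 2 * (9 * c * real n ^ 7 * L * w) * real p"
      using a by (intro mult_right_mono mult_left_mono) auto
    also have "\<dots> = 144 * c * L ^ 3 * real n ^ 7 * (w * real p)" by (simp add: eval_nat_numeral)
    also have "\<dots> \<le> 144 * c * L ^ 3 * real n ^ 7 * (65 * real n ^ 2)"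
      using w L by (intro mult_left_mono) (auto simp: c_def)
    also have "\<dots> = 9360 * c * L ^ 3 * real n ^ 9" by (simp add: eval_nat_numeral)
    finally show ?thesis by blast
  qed
qed

text \<open>The entry \<open>x2 = x4 + (x3 - x1)\<close> is determined by the others, so for given
  \<open>x1\<close> and \<open>x3\<close> the quadruples are counted by
  \<open>rep (x3 - x1)\<close>.\<close>

lemma additive_energy_le: "real (additive_energy (residue_ring (int p)) G) \<le> rep_moment 2"
proof -
  define S where "S = {(x1, x2, x3, x4). x1 \<in> G \<and> x2 \<in> G \<and> x3 \<in> G \<and> x4 \<in> G \<and> (x1 + x2) mod int p = (x3 + x4) mod int p}"
  have fin: "finite (SIGMA v:G \<times> G. {a \<in> G. unit_root (a + (snd v - fst v))})" by simp
  have "card S \<le> card (SIGMA v:G \<times> G. {a \<in> G. unit_root (a + (snd v - fst v))})"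
  proof (rule card_inj_on_le[where f = "\<lambda>(x1, x2, x3, x4). ((x1, x3), x4)", OF _ _ fin])
    show "inj_on (\<lambda>(x1, x2, x3, x4). ((x1, x3), x4)) S"
    proof (rule inj_onI, clarsimp simp: S_def)
      fix x1 x2 x3 x4 y2
      assume *: "x2 \<in> G" "y2 \<in> G" "(x1 + x2) mod int p = (x3 + x4) mod int p" "(x1 + y2) mod int p = (x3 + x4) mod int p"
      then have "[x1 + x2 = x1 + y2] (mod int p)" by (simp add: cong_def)
      then have "[x2 = y2] (mod int p)" by (simp add: cong_add_lcancel)
      then show "x2 = y2" using * F_cong_eq G_iff by blast
    qed
    show "(\<lambda>(x1, x2, x3, x4). ((x1, x3), x4)) ` S \<subseteq> (SIGMA v:G \<times> G. {a \<in> G. unit_root (a + (snd v - fst v))})"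
    proof (rule image_subsetI)
      fix v assume "v \<in> S"
      then obtain x1 x2 x3 x4 where v: "v = (x1, x2, x3, x4)" "x1 \<in> G" "x2 \<in> G" "x3 \<in> G" "x4 \<in> G"
        "(x1 + x2) mod int p = (x3 + x4) mod int p" by (auto simp: S_def)
      have "[x4 + (x3 - x1) = x2] (mod int p)"
        using cong_diff[OF v(6)[folded cong_def, THEN cong_sym] cong_refl, of x1] by (simp add: algebra_simps)
      then have "unit_root (x4 + (x3 - x1))" using root_cong v(3) G_iff by blast
      then show "(\<lambda>(x1, x2, x3, x4). ((x1, x3), x4)) v \<in> (SIGMA v:G \<times> G. {a \<in> G. unit_root (a + (snd v - fst v))})"
        using v by simp
    qed
  qed
  also have "\<dots> = (\<Sum>v\<in>G \<times> G. rep (snd v - fst v))" by (simp add: rep_def)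
  finally have "real (card S) \<le> (\<Sum>v\<in>G \<times> G. real (rep (snd v - fst v)))"
    by (metis of_nat_le_iff of_nat_sum)
  also have "\<dots> = (\<Sum>y\<in>G. \<Sum>u\<in>G. real (rep (u - y)))" by (simp add: sum.cartesian_product case_prod_unfold)
  also have "\<dots> = (\<Sum>d\<in>F. real (rep d) * real (rep d))"
    by (rule sum_rep_mult[where h = "\<lambda>d. real (rep d)", symmetric]) simp
  finally show ?thesis
    by (simp add: additive_energy_def S_def residue_ring_def rep_moment_def power2_eq_square)
qed

end

section \<open>Logarithms, subgroups and the final numerical comparison\<close>

lemma harmonic_sum_le: "n \<ge> 1 \<Longrightarrow> harmonic_sum n \<le> 1 + ln (real n)"
proof (induction n rule: dec_induct)
  case base
  then show ?case by (simp add: harmonic_sum_def)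
next
  case (step n)
  then have n: "real n > 0" by simp
  have "ln (real n / real (Suc n)) \<le> real n / real (Suc n) - 1" using n by (intro ln_le_minus_one) simp
  also have "\<dots> = - (1 / real (Suc n))" by (simp add: field_simps)
  finally have "1 / real (Suc n) \<le> ln (real (Suc n)) - ln (real n)" using n by (simp add: ln_div)
  then show ?case using step by (simp add: harmonic_sum_def)
qed

text \<open>The exponent has to be small enough for the worst power \<open>L^14\<close>: the
  available room is \<open>9 * 49/20 - 22 = 1/20\<close>, and \<open>14/400\<close> lies below
  it.\<close>

lemma harmonic_sum_le_powr: "n \<ge> 1 \<Longrightarrow> harmonic_sum n \<le> 401 * real n powr (1 / 400)"
proof -
  assume n: "n \<ge> 1"
  have "ln (real n) \<le> 400 * real n powr (1 / 400)" using ln_powr_bound[of "real n" "1 / 400"] n by simp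
  moreover have "1 \<le> real n powr (1 / 400)" using n by (simp add: ge_one_powr_ge_zero)
  ultimately show ?thesis using harmonic_sum_le[OF n] by linarith
qed

lemma le_mult_of_power_le:
  fixes E T K :: real
  assumes "0 \<le> T" "1 \<le> K" "E ^ k \<le> K * T ^ k" "k > 0"
  shows "E \<le> K * T"
proof (rule power_le_imp_le_base[of _ "k - 1"])
  have "K \<le> K ^ k" using assms by (simp add: self_le_power)
  then have "K * T ^ k \<le> (K * T) ^ k" using assms by (simp add: power_mult_distrib mult_right_mono)
  then show "E ^ Suc (k - 1) \<le> (K * T) ^ Suc (k - 1)" using assms by simp
qed (use assms in auto)

text \<open>Lagrange places \<Gamma> among the solutions of \<open>u ^ card \<Gamma> = 1\<close>,
  and modulo a prime there are at most \<open>card \<Gamma>\<close> of these.\<close>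

lemma subgroup_units_residue_ring:
  assumes p: "prime p" and sub: "subgroup \<Gamma> (units_of (residue_ring (int p)))"
  shows "\<Gamma> = {u \<in> {0..<int p}. [u ^ card \<Gamma> = 1] (mod int p)}"
proof -
  interpret residues_prime p "residue_ring (int p)" by unfold_locales (use p in auto)
  interpret U: group "units_of (residue_ring (int p))" by (rule units_group)
  interpret H: subgroup \<Gamma> "units_of (residue_ring (int p))" by (rule sub)
  have Hg: "group (units_of (residue_ring (int p)) \<lparr>carrier := \<Gamma>\<rparr>)" by (rule H.subgroup_is_group) (rule U.is_group)
  have sub1: "\<Gamma> \<subseteq> {1..<int p}" using H.subset prime_gt_0_nat[OF p] by (fastforce simp: units_of_def res_prime_units_eq)
  then have fin: "finite \<Gamma>" using finite_subset by blast
  have ne: "card \<Gamma> > 0" using fin H.one_closed unfolding card_gt_0_iff by blast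
  have pw: "x [^]\<^bsub>units_of (residue_ring (int p)) \<lparr>carrier := \<Gamma>\<rparr>\<^esub> k = x ^ k mod int p" if "x \<in> \<Gamma>" for x and k :: nat
  proof (induction k)
    case 0
    then show ?case using p prime_gt_1_nat[OF p] by (simp add: units_of_def res_one_eq nat_pow_def)
  next
    case (Suc k)
    then show ?case by (simp add: units_of_def res_mult_eq nat_pow_def mod_mult_left_eq mod_mult_right_eq mult.commute)
  qed
  have "[u ^ card \<Gamma> = 1] (mod int p)" if "u \<in> \<Gamma>" for u
    using group.pow_order_eq_1[OF Hg, of u] that pw[OF that] prime_gt_1_nat[OF p]
    by (simp add: Coset.order_def cong_def units_of_def res_one_eq)
  then have "\<Gamma> \<subseteq> {u \<in> {0..<int p}. [u ^ card \<Gamma> = 1] (mod int p)}" using sub1 by auto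
  moreover have "card {u \<in> {0..<int p}. [u ^ card \<Gamma> = 1] (mod int p)} \<le> card \<Gamma>"
    by (rule card_power_roots_mod_le[OF p ne, where a = 1]) (auto simp: cong_def)
  ultimately show ?thesis by (intro card_seteq finite_residues_Collect)
qed

lemma power_powr:
  fixes x :: real
  assumes "0 < x" shows "(x ^ k) powr a = x powr (real k * a)"
  using assms by (simp only: powr_realpow[symmetric] powr_powr)

text \<open>\<open>K\<close> is the constant of the heavy case, including \<open>401 ^ 14\<close>
  from \<open>L ^ 14\<close>; it dominates the constants of the other cases.\<close>

lemma (in residue_subgroup) rep_moment_2_le:
  defines "T1 \<equiv> (real n ^ 104 / real p ^ 3) powr (1 / 40)"
    and "T2 \<equiv> (real n ^ 68 / real p ^ 5) powr (1 / 24)"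
    and "K \<equiv> 884736 * 60000 ^ 5 * 401 ^ 14"
  shows "rep_moment 2 \<le> K * max T1 T2"
proof -
  define x where "x = real n"
  define q where "q = real p"
  define E where "E = rep_moment 2"
  define L where "L = harmonic_sum n"
  have x1: "x \<ge> 1" and x0: "x > 0" using n_pos by (simp_all add: x_def)
  have q0: "q > 0" using p_gt_1 by (simp add: q_def)
  have "real p \<le> real (n ^ 2)" "real (n ^ 3) \<le> real (p ^ 2)" using lower upper by (simp_all only: of_nat_le_iff)
  then have qx: "q \<le> x ^ 2" and xq: "x ^ 3 \<le> q ^ 2" by (simp_all add: x_def q_def)
  have E0: "E \<ge> 0" by (simp add: E_def rep_moment_def sum_nonneg)
  have L: "1 \<le> L" "L \<le> 401 * x powr (1 / 400)"
    using harmonic_sum_ge_1 harmonic_sum_le_powr n_pos by (simp_all add: L_def x_def Suc_le_eq)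
  have Lk: "L ^ k \<le> 401 ^ k * x powr (real k / 400)" for k
  proof -
    have "L ^ k \<le> (401 * x powr (1 / 400)) ^ k" using L by (intro power_mono) auto
    also have "\<dots> = 401 ^ k * x powr (real k / 400)" using x0 by (simp add: power_mult_distrib powr_power)
    finally show ?thesis .
  qed
  have K1: "K \<ge> 1" by (simp add: K_def)
  have T0: "T1 \<ge> 0" "T2 \<ge> 0" by (simp_all add: T1_def T2_def)
  \<comment> \<open>By \<open>p <= n^2\<close>, \<open>n^104 / p^3\<close> is at least
    \<open>n^98\<close>, and \<open>98 / 40 = 49 / 20\<close>.\<close>
  have T1: "x powr (49 / 20) \<le> T1"
  proof -
    have "q ^ 3 \<le> x ^ 6" using power_mono[OF qx, of 3] q0 by (simp flip: power_mult)
    then have "x ^ 98 * q ^ 3 \<le> x ^ 98 * x ^ 6" using x0 by (intro mult_left_mono) auto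
    also have "\<dots> = x ^ 104" by (simp flip: power_add)
    finally have "x ^ 98 \<le> x ^ 104 / q ^ 3" using q0 by (simp add: field_simps)
    then have "(x ^ 98) powr (1 / 40) \<le> T1" unfolding T1_def x_def[symmetric] q_def[symmetric]
      using x0 by (intro powr_mono2) auto
    moreover have "(x ^ 98) powr (1 / 40) = x powr (49 / 20)" using x0 by (simp add: power_powr)
    ultimately show ?thesis by simp
  qed
  have T1k: "x powr a \<le> T1 ^ k" if "a \<le> 49 / 20 * real k" for a k
  proof -
    have "x powr a \<le> x powr (49 / 20 * real k)" using that x1 by (rule powr_mono)
    also have "\<dots> = (x powr (49 / 20)) ^ k" using x0 by (simp add: powr_power mult.commute)
    also have "\<dots> \<le> T1 ^ k" using T1 by (intro power_mono) auto
    finally show ?thesis .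
  qed
  have "E \<le> K * T1 \<or> E \<le> K * T2"
  proof (cases "2 * x ^ 2 < E")
    case False
    have "x ^ 2 = x powr 2" using x0 by (simp add: powr_numeral)
    also have "\<dots> \<le> T1" using T1k[of 2 1] by simp
    finally have "E \<le> 2 * T1" using False by simp
    also have "\<dots> \<le> K * T1" using T0 by (intro mult_right_mono) (simp_all add: K_def)
    finally show ?thesis by blast
  next
    case True
    then consider "E ^ 9 \<le> 884736 * 60000 ^ 5 * L ^ 14 * x ^ 22" | "E ^ 3 * q \<le> 9360 * 60000 * L ^ 3 * x ^ 9" |
      "E ^ 3 \<le> 48 * 60000 * L ^ 3 * x ^ 7"
      using rep_moment_2_trichotomy unfolding E_def L_def x_def q_def by blast
    then show ?thesis
    proof cases
      case 1
      have "L ^ 14 * x ^ 22 \<le> 401 ^ 14 * x powr (real 14 / 400) * x powr 22"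
        using Lk[of 14] x0 by (simp add: powr_numeral mult_right_mono)
      also have "\<dots> = 401 ^ 14 * x powr (real 14 / 400 + 22)" by (simp only: powr_add mult.assoc)
      also have "\<dots> \<le> 401 ^ 14 * T1 ^ 9" by (intro mult_left_mono T1k) auto
      finally have "884736 * 60000 ^ 5 * (L ^ 14 * x ^ 22) \<le> 884736 * 60000 ^ 5 * (401 ^ 14 * T1 ^ 9)"
        by (intro mult_left_mono) auto
      then have "E ^ 9 \<le> K * T1 ^ 9" using 1 unfolding K_def by (simp only: mult.assoc)
      then show ?thesis using le_mult_of_power_le[OF T0(1) K1, of E 9] by simp
    next
      case 2
      have T2: "T2 ^ 3 * q = x powr (17 / 2) * q powr (3 / 8)"
      proof -
        have "T2 ^ 3 = (x ^ 68 / q ^ 5) powr (1 / 8)" unfolding T2_def x_def[symmetric] q_def[symmetric]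
          using x0 q0 by (simp add: powr_power)
        also have "\<dots> = x powr (17 / 2) / q powr (5 / 8)"
          using x0 q0 by (simp add: powr_divide power_powr)
        finally have "T2 ^ 3 * q = x powr (17 / 2) * (q powr 1 / q powr (5 / 8))" using q0 by simp
        also have "q powr 1 / q powr (5 / 8) = q powr (3 / 8)" by (simp only: powr_diff[symmetric]) simp
        finally show ?thesis .
      qed
      \<comment> \<open>This is \<open>n^3 <= p^2\<close> to the power \<open>3/16\<close>. It gives
        \<open>T2^3 * q >= x^(9 + 1/16)\<close>, which leaves room for the \<open>x^(3/400)\<close>
        coming from \<open>L^3\<close>.\<close>
      have "x powr (9 / 16) \<le> q powr (3 / 8)"
      proof -
        have "(x ^ 3) powr (3 / 16) \<le> (q ^ 2) powr (3 / 16)" using xq x0 by (intro powr_mono2) auto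
        then show ?thesis using x0 q0 by (simp add: power_powr)
      qed
      then have "x powr (17 / 2) * x powr (9 / 16) \<le> T2 ^ 3 * q" unfolding T2 by (intro mult_left_mono) auto
      moreover have "x powr (real 3 / 400 + 9) \<le> x powr (17 / 2 + 9 / 16)" using x1 by (intro powr_mono) auto
      ultimately have a: "x powr (real 3 / 400 + 9) \<le> T2 ^ 3 * q" by (simp only: powr_add)
      have "L ^ 3 * x ^ 9 \<le> 401 ^ 3 * x powr (real 3 / 400) * x powr 9"
        using Lk[of 3] x0 by (simp add: powr_numeral mult_right_mono)
      also have "\<dots> = 401 ^ 3 * x powr (real 3 / 400 + 9)" by (simp only: powr_add mult.assoc)
      also have "\<dots> \<le> 401 ^ 3 * (T2 ^ 3 * q)" using a by (intro mult_left_mono) auto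
      finally have "9360 * 60000 * (L ^ 3 * x ^ 9) \<le> 9360 * 60000 * (401 ^ 3 * (T2 ^ 3 * q))"
        by (intro mult_left_mono) auto
      also have "\<dots> = (9360 * 60000 * 401 ^ 3) * (T2 ^ 3 * q)" by (simp only: mult.assoc)
      also have "\<dots> \<le> K * (T2 ^ 3 * q)" using T0 q0 by (intro mult_right_mono) (simp_all add: K_def)
      finally have "E ^ 3 * q \<le> (K * T2 ^ 3) * q" using 2 by (simp only: mult.assoc)
      then have "E ^ 3 \<le> K * T2 ^ 3" using q0 by (simp only: mult_le_cancel_right_pos)
      then show ?thesis using le_mult_of_power_le[OF T0(2) K1, of E 3] by simp
    next
      case 3
      have "L ^ 3 * x ^ 7 \<le> 401 ^ 3 * x powr (real 3 / 400) * x powr 7"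
        using Lk[of 3] x0 by (simp add: powr_numeral mult_right_mono)
      also have "\<dots> = 401 ^ 3 * x powr (real 3 / 400 + 7)" by (simp only: powr_add mult.assoc)
      also have "\<dots> \<le> 401 ^ 3 * T1 ^ 3" by (intro mult_left_mono T1k) auto
      finally have "48 * 60000 * (L ^ 3 * x ^ 7) \<le> 48 * 60000 * (401 ^ 3 * T1 ^ 3)"
        by (intro mult_left_mono) auto
      also have "\<dots> = (48 * 60000 * 401 ^ 3) * T1 ^ 3" by (simp only: mult.assoc)
      also have "\<dots> \<le> K * T1 ^ 3" using T0 by (intro mult_right_mono) (simp_all add: K_def)
      finally have "E ^ 3 \<le> K * T1 ^ 3" using 3 by (simp only: mult.assoc)
      then show ?thesis using le_mult_of_power_le[OF T0(1) K1, of E 3] by simp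
    qed
  qed
  moreover have "K * T1 \<le> K * max T1 T2" "K * T2 \<le> K * max T1 T2" using K1 by (intro mult_left_mono; simp)+
  ultimately show ?thesis unfolding E_def by linarith
qed

theorem theorem19:
  "\<exists>C::real. \<forall>(p::nat) (\<Gamma>::int set).
     prime p \<longrightarrow>
     subgroup \<Gamma> (units_of (residue_ring (int p))) \<longrightarrow>
     real p powr (1/2) \<le> real (card \<Gamma>) \<longrightarrow>
     real (card \<Gamma>) \<le> real p powr (2/3) \<longrightarrow>
     real (additive_energy (residue_ring (int p)) \<Gamma>)
       \<le> C * log 2 (real (card \<Gamma>)) powr (1/4) *
          max ((real (card \<Gamma>) ^ 104 / real p ^ 3) powr (1/40))
              ((real (card \<Gamma>) ^ 68 / real p ^ 5) powr (1/24))"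
proof (intro exI allI impI)
  fix p :: nat and \<Gamma> :: "int set"
  assume p: "prime p" and sub: "subgroup \<Gamma> (units_of (residue_ring (int p)))"
    and lo: "real p powr (1/2) \<le> real (card \<Gamma>)" and up: "real (card \<Gamma>) \<le> real p powr (2/3)"
  define n where "n = card \<Gamma>"
  have p2: "real p \<ge> 2" using prime_ge_2_nat[OF p] by simp
  have "real p = (real p powr (1/2)) ^ 2" using p2 by (simp add: powr_power)
  also have "\<dots> \<le> real n ^ 2" using lo by (intro power_mono) (auto simp: n_def)
  finally have "real p \<le> real (n ^ 2)" by simp
  then have pn: "p \<le> n ^ 2" by (simp only: of_nat_le_iff)
  have "real n ^ 3 \<le> (real p powr (2/3)) ^ 3" using up by (intro power_mono) (auto simp: n_def)
  also have "\<dots> = real p ^ 2" using p2 by (simp add: powr_power powr_numeral)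
  finally have "real (n ^ 3) \<le> real (p ^ 2)" by simp
  then have np: "n ^ 3 \<le> p ^ 2" by (simp only: of_nat_le_iff)
  interpret residue_subgroup p n \<Gamma>
    by unfold_locales (use p pn np subgroup_units_residue_ring[OF p sub] in \<open>simp_all add: n_def\<close>)
  \<comment> \<open>The trivial subgroup is excluded by \<open>2 <= p <= n^2\<close>; hence the
    logarithm is at least 1 and its power only enlarges the right-hand side.\<close>
  have "n \<noteq> 1" using pn prime_ge_2_nat[OF p] by auto
  then have "real n \<ge> 2" using n_pos by simp
  then have "log 2 (real n) \<ge> 1" by (simp add: le_log_iff)
  then have "1 \<le> log 2 (real n) powr (1/4)" by (simp add: ge_one_powr_ge_zero)
  then have "1 * max ((real n ^ 104 / real p ^ 3) powr (1/40)) ((real n ^ 68 / real p ^ 5) powr (1/24)) \<le>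
    log 2 (real n) powr (1/4) * max ((real n ^ 104 / real p ^ 3) powr (1/40)) ((real n ^ 68 / real p ^ 5) powr (1/24))"
    by (intro mult_right_mono) (auto simp: le_max_iff_disj)
  then have "884736 * 60000 ^ 5 * 401 ^ 14 * max ((real n ^ 104 / real p ^ 3) powr (1/40)) ((real n ^ 68 / real p ^ 5) powr (1/24)) \<le>
    884736 * 60000 ^ 5 * 401 ^ 14 * (log 2 (real n) powr (1/4) *
      max ((real n ^ 104 / real p ^ 3) powr (1/40)) ((real n ^ 68 / real p ^ 5) powr (1/24)))"
    by (intro mult_left_mono) simp_all
  then show "real (additive_energy (residue_ring (int p)) \<Gamma>)
       \<le> (884736 * 60000 ^ 5 * 401 ^ 14) * log 2 (real (card \<Gamma>)) powr (1/4) *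
          max ((real (card \<Gamma>) ^ 104 / real p ^ 3) powr (1/40))
              ((real (card \<Gamma>) ^ 68 / real p ^ 5) powr (1/24))"
    using additive_energy_le rep_moment_2_le unfolding n_def[symmetric] mult.assoc by linarith
qed

end
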